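(* Let $\mu>0$, $1<p<+\infty$ and $f\in L^p([0,1])$. Then for every sufficiently large $n\in\mathbb{N}$, $$\|\mathscr{L}_n^K f-f\|_p\le\frac{\ln(2+\mu)}{\ln(1+\mu)}(K_\mu+1)\,\widetilde{\mathcal{K}}(f,\Gamma_n)_p,$$ where $K_\mu:=1+\frac{1}{1+\mu}$, $\Gamma_n:=2^{\frac{p-1}{p}}C_{p,\mu}\frac{\ln(2+\mu)}{\ln(1+\mu)}(K_\mu+1)^{-1}T_n$, $T_n:=\frac{1}{2(n+1)}+\frac{\sqrt2}{\sqrt{n+1}}+\gamma_n$, $\gamma_n:=\max_{x\in[0,1]}|a_{n+1}(x)-x|$, and $C_{p,\mu}:=\max\left\{\frac{1}{(1+\mu)\ln(1+\mu)},\,C_p\right\}$.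
   Context: Fix $\mu>0$. Let $\ln_\mu(x):=\ln(1+\mu+x)$ for $x\in[0,1]$, and for $f:[0,1]\to\mathbb{R}$ let $f_\mu(x):=f(x)/\ln_\mu(x)$. Let $p_{n,k}(y):=\binom{n}{k}y^k(1-y)^{n-k}$ and $a_{n+1}(x):=\dfrac{\ln\left(1+\frac{x}{(n+1)(1+\mu)}\right)}{\ln\left(1+\frac{1}{(n+1)(1+\mu)}\right)}$, $x\in[0,1]$. For $n\in\mathbb{N}$ define $\mathscr{L}_n^K f(x):=\ln_\mu(x)\sum_{k=0}^n p_{n,k}(a_{n+1}(x))\,(n+1)\int_{k/(n+1)}^{(k+1)/(n+1)} f_\mu(t)\,dt$, $x\in[0,1]$. $W^{1,p}([0,1])$ is the Sobolev space of absolutely continuous $g:[0,1]\to\mathbb{R}$ with $g'\in L^p([0,1])$, normed by $\|g\|_{W^{1,p}}:=\|g\|_p+\|g'\|_p$, and $\widetilde{\mathcal{K}}(f,t)_p:=\inf_{g\in W^{1,p}([0,1])}\{\|f-g\|_p+t\|g\|_{W^{1,p}}\}$ for $t>0$. The Hardy–Littlewood maximal function is $M(f;x):=\sup_{0<t\le1,\,t\ne x}\frac{1}{t-x}\int_x^t|f(u)|\,du$, and $C_p>0$ denotes a constant depending only on $p$ such that $\|M(f;\cdot)\|_p\le C_p\|f\|_p$ for all $f\in L^p([0,1])$. *)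

theory Defs
  imports "HOL-Analysis.Analysis"
begin

definition in_Lp01 :: "real \<Rightarrow> (real \<Rightarrow> real) \<Rightarrow> bool" where
  "in_Lp01 p f \<longleftrightarrow> set_borel_measurable lborel {0..1} f \<and>
     set_integrable lborel {0..1} (\<lambda>x. \<bar>f x\<bar> powr p)"

definition Lp_norm01 :: "real \<Rightarrow> (real \<Rightarrow> real) \<Rightarrow> real" where
  "Lp_norm01 p f = (LINT x:{0..1}|lborel. \<bar>f x\<bar> powr p) powr (1 / p)"

definition abs_cont01 :: "(real \<Rightarrow> real) \<Rightarrow> bool" where
  "abs_cont01 g \<longleftrightarrow> (\<forall>\<epsilon>>0. \<exists>\<delta>>0. \<forall>(n::nat) a b.
     (\<forall>i<n. 0 \<le> a i \<and> a i \<le> b i \<and> b i \<le> 1) \<and>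
     (\<forall>i<n. \<forall>j<n. i \<noteq> j \<longrightarrow> b i \<le> a j \<or> b j \<le> a i) \<and>
     (\<Sum>i<n. b i - a i) < \<delta> \<longrightarrow> (\<Sum>i<n. \<bar>g (b i) - g (a i)\<bar>) < \<epsilon>)"

definition W1p_deriv :: "real \<Rightarrow> (real \<Rightarrow> real) \<Rightarrow> (real \<Rightarrow> real) \<Rightarrow> bool" where
  "W1p_deriv p g h \<longleftrightarrow> abs_cont01 g \<and> in_Lp01 p h \<and>
     (AE x in lborel. x \<in> {0..1} \<longrightarrow> (g has_real_derivative h x) (at x within {0..1}))"

text \<open>Modified K-functional; \<open>\<parallel>g\<parallel>_{W^{1,p}} = \<parallel>g\<parallel>_p + \<parallel>g'\<parallel>_p\<close>.\<close>
definition Kfun :: "real \<Rightarrow> (real \<Rightarrow> real) \<Rightarrow> real \<Rightarrow> real" where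
  "Kfun p f t = Inf {Lp_norm01 p (\<lambda>x. f x - g x) + t * (Lp_norm01 p g + Lp_norm01 p h)
                     | g h. W1p_deriv p g h}"

definition maxfun :: "(real \<Rightarrow> real) \<Rightarrow> real \<Rightarrow> ereal" where
  "maxfun f x = (SUP t\<in>{0<..1} - {x}.
      ereal (interval_lebesgue_integral lborel (ereal x) (ereal t) (\<lambda>u. \<bar>f u\<bar>) / (t - x)))"

definition maximal_const :: "real \<Rightarrow> real \<Rightarrow> bool" where
  "maximal_const p C \<longleftrightarrow> C > 0 \<and> (\<forall>f. in_Lp01 p f \<longrightarrow>
     (AE x in lborel. x \<in> {0..1} \<longrightarrow> maxfun f x < \<infinity>) \<and>
     in_Lp01 p (\<lambda>x. real_of_ereal (maxfun f x)) \<and>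
     Lp_norm01 p (\<lambda>x. real_of_ereal (maxfun f x)) \<le> C * Lp_norm01 p f)"

definition ln_mu :: "real \<Rightarrow> real \<Rightarrow> real" where
  "ln_mu \<mu> x = ln (1 + \<mu> + x)"

definition f_mu :: "real \<Rightarrow> (real \<Rightarrow> real) \<Rightarrow> real \<Rightarrow> real" where
  "f_mu \<mu> f x = f x / ln_mu \<mu> x"

definition bern :: "nat \<Rightarrow> nat \<Rightarrow> real \<Rightarrow> real" where
  "bern n k y = real (n choose k) * y ^ k * (1 - y) ^ (n - k)"

definition a_seq :: "real \<Rightarrow> nat \<Rightarrow> real \<Rightarrow> real" where
  "a_seq \<mu> m x = ln (1 + x / (real m * (1 + \<mu>))) / ln (1 + 1 / (real m * (1 + \<mu>)))"

definition LK :: "real \<Rightarrow> nat \<Rightarrow> (real \<Rightarrow> real) \<Rightarrow> real \<Rightarrow> real" where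
  "LK \<mu> n f x = ln_mu \<mu> x * (\<Sum>k\<le>n. bern n k (a_seq \<mu> (n + 1) x) * real (n + 1) *
      interval_lebesgue_integral lborel (ereal (real k / real (n + 1)))
        (ereal (real (k + 1) / real (n + 1))) (f_mu \<mu> f))"

definition K_mu :: "real \<Rightarrow> real" where
  "K_mu \<mu> = 1 + 1 / (1 + \<mu>)"

definition gamma_n :: "real \<Rightarrow> nat \<Rightarrow> real" where
  "gamma_n \<mu> n = (SUP x\<in>{0..1}. \<bar>a_seq \<mu> (n + 1) x - x\<bar>)"

definition T_n :: "real \<Rightarrow> nat \<Rightarrow> real" where
  "T_n \<mu> n = 1 / (2 * real (n + 1)) + sqrt 2 / sqrt (real (n + 1)) + gamma_n \<mu> n"

definition C_p_mu :: "real \<Rightarrow> real \<Rightarrow> real" where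
  "C_p_mu Cp \<mu> = max (1 / ((1 + \<mu>) * ln (1 + \<mu>))) Cp"

definition Gamma_n :: "real \<Rightarrow> real \<Rightarrow> real \<Rightarrow> nat \<Rightarrow> real" where
  "Gamma_n p Cp \<mu> n = 2 powr ((p - 1) / p) * C_p_mu Cp \<mu> * (ln (2 + \<mu>) / ln (1 + \<mu>))
      * inverse (K_mu \<mu> + 1) * T_n \<mu> n"

end

theory Submission
  imports Defs
begin

text \<open>
  For a Sobolev function \<open>g\<close> split \<open>L f - f = L (f - g) - (f - g) + (L g - g)\<close>, where \<open>L\<close> is the operator.
  By convexity of \<open>s \<mapsto> s powr p\<close>, by \<open>1 \<le> K_mu \<mu> * a'\<close> and by the Bernstein basis functions
  having integral \<open>1 / (n + 1)\<close>, the operator norm of \<open>L\<close> on \<open>L\<^sup>p\<close> is at most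
  \<open>ln (2 + \<mu>) / ln (1 + \<mu>) * K_mu \<mu>\<close>. Since \<open>G = g / ln_mu\<close> is absolutely continuous,
  \<open>\<bar>G t - G x\<bar>\<close> is at most \<open>\<bar>t - x\<bar>\<close> times the maximal function of \<open>G'\<close> at \<open>x\<close>, so
  \<open>L g - g\<close> is controlled by that maximal function times the mean of \<open>\<bar>t - x\<bar>\<close> under the kernel
  of \<open>L\<close>, which is \<open>1 / (2 * sqrt n) + O(1 / n)\<close>.
\<close>

text \<open>The constants of the statement shape the bookkeeping. The derivative of \<open>G\<close>
  contains \<open>g\<close> as well as its derivative, which is why the full Sobolev norm is needed,
  and the coefficient of \<open>g\<close> is the origin of the first entry of the maximum
  \<open>C_p_mu\<close>. The estimate produces the product of \<open>Cp\<close> with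
  \<open>max 1 (1 / ((1 + \<mu>) * ln (1 + \<mu>)))\<close>, which \<open>C_p_mu\<close> alone need
  not dominate. Two reserves cover the deficit: a second factor
  \<open>ln (2 + \<mu>) / ln (1 + \<mu>)\<close> hidden in \<open>Gamma_n\<close>, and the ratio of
  \<open>1 / (2 * sqrt n)\<close> to \<open>sqrt 2 / sqrt (n + 1)\<close>, whose limit
  \<open>1 / (2 * sqrt 2)\<close> lies well below \<open>2 / 3\<close>, itself a lower bound of
  \<open>ln 2\<close>. The second reserve is where n must be large; 48 is enough for all \<mu>, p
  and f at once. In \<open>Gamma_n\<close> the power of 2 is a factor at least 1, and
  \<open>inverse (K_mu \<mu> + 1)\<close> cancels against the outer factor.\<close>

section \<open>The space L^p on the unit interval\<close>

text \<open>Young's inequality with \<open>m powr (p - 1)\<close>; this form includes the endpoint \<open>0\<close>, where the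
  library's \<open>powr_convex\<close> stops.\<close>
lemma powr_tangent_le:
  fixes p s m :: real
  assumes "p > 1" "s \<ge> 0" "m \<ge> 0"
  shows "m powr p + p * m powr (p - 1) * (s - m) \<le> s powr p"
proof -
  define q where "q = p / (p - 1)"
  have q: "q > 1" "1 / p + 1 / q = 1" using assms by (simp_all add: q_def field_simps)
  have mq: "(m powr (p - 1)) powr q = m powr p" using assms by (simp add: powr_powr q_def)
  have "s * m powr (p - 1) \<le> s powr p / p + (m powr (p - 1)) powr q / q"
    using assms q by (intro Youngs_inequality) auto
  then have "p * (s * m powr (p - 1)) \<le> p * (s powr p / p + m powr p / q)"
    using assms by (simp add: mq)
  also have "\<dots> = s powr p + (p - 1) * m powr p"
    using assms by (simp add: q_def field_simps)
  finally have "p * (s * m powr (p - 1)) \<le> s powr p + (p - 1) * m powr p" .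
  moreover have "m powr (p - 1) * m = m powr p"
    using assms by (cases "m = 0") (auto simp: powr_diff)
  ultimately show ?thesis by (simp add: algebra_simps)
qed

text \<open>Jensen's inequality: the tangents at the mean \<open>m\<close> are summed against the
  weights, and the linear part vanishes because the weights sum to 1.\<close>

lemma powr_convex_sum:
  fixes p :: real
  assumes "p > 1" "finite I" "\<And>i. i \<in> I \<Longrightarrow> w i \<ge> 0" "sum w I = 1" "\<And>i. i \<in> I \<Longrightarrow> s i \<ge> 0"
  shows "(\<Sum>i\<in>I. w i * s i) powr p \<le> (\<Sum>i\<in>I. w i * s i powr p)"
proof -
  define m where "m = (\<Sum>i\<in>I. w i * s i)"
  have m: "m \<ge> 0" unfolding m_def using assms by (intro sum_nonneg) auto
  have "(\<Sum>i\<in>I. w i * (m powr p + p * m powr (p - 1) * (s i - m))) \<le> (\<Sum>i\<in>I. w i * s i powr p)"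
    using assms m by (intro sum_mono mult_left_mono powr_tangent_le) auto
  also have "(\<Sum>i\<in>I. w i * (m powr p + p * m powr (p - 1) * (s i - m)))
      = (\<Sum>i\<in>I. w i * (m powr p - p * m powr (p - 1) * m) + p * m powr (p - 1) * (w i * s i))"
    by (intro sum.cong) (auto simp: algebra_simps)
  also have "\<dots> = sum w I * (m powr p - p * m powr (p - 1) * m) + p * m powr (p - 1) * m"
    by (simp only: sum.distrib sum_distrib_right[symmetric] sum_distrib_left[symmetric] m_def)
  finally show ?thesis using assms by (simp add: m_def)
qed

text \<open>Strictly positive upper bounds \<open>a\<close>, \<open>b\<close> replace the norms, so
  that normalising by them never divides by zero. Convexity is applied to
  \<open>\<bar>u x\<bar> / a\<close> and \<open>\<bar>v x\<bar> / b\<close> with weights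
  \<open>a / (a + b)\<close> and \<open>b / (a + b)\<close>, which makes the resulting constant
  exactly \<open>a + b\<close>.\<close>

lemma minkowski_bound:
  fixes p :: real and u v :: "'a \<Rightarrow> real"
  assumes "p > 1" and [measurable]: "u \<in> borel_measurable M" "v \<in> borel_measurable M"
    and u: "integrable M (\<lambda>x. \<bar>u x\<bar> powr p)" and v: "integrable M (\<lambda>x. \<bar>v x\<bar> powr p)"
    and a: "a > 0" "(LINT x|M. \<bar>u x\<bar> powr p) \<le> a powr p"
    and b: "b > 0" "(LINT x|M. \<bar>v x\<bar> powr p) \<le> b powr p"
  shows "integrable M (\<lambda>x. \<bar>u x + v x\<bar> powr p)"
    and "(LINT x|M. \<bar>u x + v x\<bar> powr p) \<le> (a + b) powr p"
proof -
  define R where "R x = (a + b) powr p * (a / (a + b) * (\<bar>u x\<bar> powr p / a powr p)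
      + b / (a + b) * (\<bar>v x\<bar> powr p / b powr p))" for x
  have bnd: "\<bar>u x + v x\<bar> powr p \<le> R x" for x
  proof -
    have "\<bar>u x + v x\<bar> powr p \<le> (\<bar>u x\<bar> + \<bar>v x\<bar>) powr p"
      using \<open>p > 1\<close> by (intro powr_mono2) auto
    also have "\<bar>u x\<bar> + \<bar>v x\<bar> = (a + b) * (a / (a + b) * (\<bar>u x\<bar> / a) + b / (a + b) * (\<bar>v x\<bar> / b))"
    proof -
      have "a / (a + b) * (\<bar>u x\<bar> / a) + b / (a + b) * (\<bar>v x\<bar> / b) = (\<bar>u x\<bar> + \<bar>v x\<bar>) / (a + b)"
        using a(1) b(1) by (simp add: add_divide_distrib)
      then show ?thesis using a(1) b(1) by simp
    qed
    also have "\<dots> powr p = (a + b) powr p * (a / (a + b) * (\<bar>u x\<bar> / a) + b / (a + b) * (\<bar>v x\<bar> / b)) powr p"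
      using a b by (intro powr_mult)
    also have "\<dots> \<le> R x"
    proof -
      \<comment> \<open>The two-point case of the finite Jensen inequality, with \<open>bool\<close>
        as index set.\<close>
      have "(\<Sum>i\<in>(UNIV::bool set). (if i then a / (a + b) else b / (a + b)) *
              (if i then \<bar>u x\<bar> / a else \<bar>v x\<bar> / b)) powr p
          \<le> (\<Sum>i\<in>(UNIV::bool set). (if i then a / (a + b) else b / (a + b)) *
              (if i then \<bar>u x\<bar> / a else \<bar>v x\<bar> / b) powr p)"
        using a(1) b(1) \<open>p > 1\<close>
        by (intro powr_convex_sum) (auto simp: UNIV_bool add_divide_distrib[symmetric])
      then have "(a / (a + b) * (\<bar>u x\<bar> / a) + b / (a + b) * (\<bar>v x\<bar> / b)) powr p
          \<le> a / (a + b) * (\<bar>u x\<bar> / a) powr p + b / (a + b) * (\<bar>v x\<bar> / b) powr p"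
        by (simp add: UNIV_bool add.commute)
      also have "\<dots> = a / (a + b) * (\<bar>u x\<bar> powr p / a powr p) + b / (a + b) * (\<bar>v x\<bar> powr p / b powr p)"
        using a b by (simp add: powr_divide)
      finally show ?thesis by (simp add: R_def mult_left_mono)
    qed
    finally show ?thesis .
  qed
  have R: "integrable M R" unfolding R_def using u v by auto
  show int: "integrable M (\<lambda>x. \<bar>u x + v x\<bar> powr p)"
    using R by (rule Bochner_Integration.integrable_bound) (auto intro!: AE_I2 order_trans[OF bnd])
  have "(LINT x|M. \<bar>u x + v x\<bar> powr p) \<le> (LINT x|M. R x)"
    using int R bnd by (intro integral_mono) auto
  also have "\<dots> = (a + b) powr p * (a / (a + b) * ((LINT x|M. \<bar>u x\<bar> powr p) / a powr p)
      + b / (a + b) * ((LINT x|M. \<bar>v x\<bar> powr p) / b powr p))"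
    unfolding R_def using u v by simp
  also have "\<dots> \<le> (a + b) powr p * (a / (a + b) * 1 + b / (a + b) * 1)"
    using a b by (intro mult_left_mono add_mono) auto
  also have "\<dots> = (a + b) powr p" using a(1) b(1) by (simp add: add_divide_distrib[symmetric])
  finally show "(LINT x|M. \<bar>u x + v x\<bar> powr p) \<le> (a + b) powr p" .
qed

lemma abs_indicator_powr: "\<bar>indicator A x * (f x :: real)\<bar> powr p = indicator A x * \<bar>f x\<bar> powr p"
  by (simp add: indicator_def)

lemma in_Lp01_iff:
  "in_Lp01 p f \<longleftrightarrow> (\<lambda>x. indicator {0..1} x * f x) \<in> borel_measurable lborel \<and>
     integrable lborel (\<lambda>x. \<bar>indicator {0..1} x * f x\<bar> powr p)"
  by (simp add: in_Lp01_def set_borel_measurable_def set_integrable_def abs_indicator_powr)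

lemma Lp_norm01_eq: "Lp_norm01 p f = (LINT x|lborel. \<bar>indicator {0..1} x * f x\<bar> powr p) powr (1 / p)"
  by (simp add: Lp_norm01_def set_lebesgue_integral_def abs_indicator_powr)

lemma Lp_norm01_nonneg [simp]: "0 \<le> Lp_norm01 p f"
  by (simp add: Lp_norm01_def)

lemma Lp_norm01_powr:
  assumes "p > 0"
  shows "Lp_norm01 p f powr p = (LINT x|lborel. \<bar>indicator {0..1} x * f x\<bar> powr p)"
  using assms by (simp add: Lp_norm01_eq powr_powr integral_nonneg_AE)

lemma Lp_norm01_leI:
  assumes "p > 0" "c \<ge> 0" "(LINT x|lborel. \<bar>indicator {0..1} x * f x\<bar> powr p) \<le> c powr p"
  shows "Lp_norm01 p f \<le> c"
proof -
  have "Lp_norm01 p f powr p \<le> c powr p" using assms by (simp add: Lp_norm01_powr)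
  then show ?thesis using assms by (meson Lp_norm01_nonneg linorder_not_less powr_less_mono2)
qed

lemma in_Lp01_add:
  assumes "p > 1" "in_Lp01 p f" "in_Lp01 p g"
  shows "in_Lp01 p (\<lambda>x. f x + g x)" "Lp_norm01 p (\<lambda>x. f x + g x) \<le> Lp_norm01 p f + Lp_norm01 p g"
proof -
  let ?u = "\<lambda>x. indicator {0..1} x * f x" and ?v = "\<lambda>x. indicator {0..1} x * g x"
  have m: "?u \<in> borel_measurable lborel" "?v \<in> borel_measurable lborel"
     "integrable lborel (\<lambda>x. \<bar>?u x\<bar> powr p)" "integrable lborel (\<lambda>x. \<bar>?v x\<bar> powr p)"
    using assms by (simp_all add: in_Lp01_iff)
  have uv: "?u x + ?v x = indicator {0..1} x * (f x + g x)" for x by (simp add: algebra_simps)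
  \<comment> \<open>The shift by \<open>e\<close> keeps the bounds positive when a norm is zero;
    \<open>field_le_epsilon\<close> removes it at the end.\<close>
  have *: "(LINT x|lborel. \<bar>?u x\<bar> powr p) \<le> (Lp_norm01 p f + e) powr p"
      "(LINT x|lborel. \<bar>?v x\<bar> powr p) \<le> (Lp_norm01 p g + e) powr p" if "e > 0" for e
    using that assms(1) by (simp_all add: Lp_norm01_powr[symmetric] powr_mono2)
  have M: "integrable lborel (\<lambda>x. \<bar>?u x + ?v x\<bar> powr p)"
     "(LINT x|lborel. \<bar>?u x + ?v x\<bar> powr p) \<le> (Lp_norm01 p f + e + (Lp_norm01 p g + e)) powr p"
     if "e > 0" for e
    using minkowski_bound[OF assms(1) m add_nonneg_pos *(1) add_nonneg_pos *(2), of e e] that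
    by simp_all
  have "(\<lambda>x. ?u x + ?v x) \<in> borel_measurable lborel" using m(1,2) by measurable
  then show "in_Lp01 p (\<lambda>x. f x + g x)"
    using M(1)[of 1] unfolding in_Lp01_iff uv by simp
  show "Lp_norm01 p (\<lambda>x. f x + g x) \<le> Lp_norm01 p f + Lp_norm01 p g"
  proof (rule field_le_epsilon)
    fix e :: real assume e: "e > 0"
    have "Lp_norm01 p (\<lambda>x. f x + g x) \<le> Lp_norm01 p f + e / 2 + (Lp_norm01 p g + e / 2)"
      using M(2)[of "e / 2"] e assms(1) unfolding uv by (intro Lp_norm01_leI) auto
    then show "Lp_norm01 p (\<lambda>x. f x + g x) \<le> Lp_norm01 p f + Lp_norm01 p g + e" by simp
  qed
qed

lemma in_Lp01_cmult:
  assumes "p > 0" "in_Lp01 p f"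
  shows "in_Lp01 p (\<lambda>x. c * f x)" "Lp_norm01 p (\<lambda>x. c * f x) = \<bar>c\<bar> * Lp_norm01 p f"
proof -
  have eq: "indicator {0..1} x * (c * f x) = c * (indicator {0..1} x * f x)" for x by simp
  show "in_Lp01 p (\<lambda>x. c * f x)" using assms
    unfolding in_Lp01_iff eq abs_mult[of c] powr_mult by auto
  show "Lp_norm01 p (\<lambda>x. c * f x) = \<bar>c\<bar> * Lp_norm01 p f" using assms
    unfolding Lp_norm01_eq eq abs_mult[of c] powr_mult 
    by (simp add: powr_mult powr_powr)
qed

text \<open>The almost-everywhere form is what a comparison with the maximal function can supply,
  since that function is known to be finite only almost everywhere.\<close>

lemma in_Lp01_mono:
  assumes p: "p > 0" and F: "in_Lp01 p F"
    and f: "set_borel_measurable lborel {0..1} f"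
    and le: "AE x in lborel. x \<in> {0..1} \<longrightarrow> \<bar>f x\<bar> \<le> \<bar>F x\<bar>"
  shows "in_Lp01 p f" "Lp_norm01 p f \<le> Lp_norm01 p F"
proof -
  let ?u = "\<lambda>x. indicator {0..1} x * f x" and ?v = "\<lambda>x. indicator {0..1} x * F x"
  have m[measurable]: "?u \<in> borel_measurable lborel" using f by (simp add: set_borel_measurable_def)
  have F': "integrable lborel (\<lambda>x. \<bar>?v x\<bar> powr p)" using F by (simp add: in_Lp01_iff)
  have le': "AE x in lborel. \<bar>?u x\<bar> powr p \<le> \<bar>?v x\<bar> powr p"
    using le by eventually_elim (use p in \<open>auto simp: indicator_def intro!: powr_mono2\<close>)
  have I: "integrable lborel (\<lambda>x. \<bar>?u x\<bar> powr p)"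
    by (rule Bochner_Integration.integrable_bound[OF F']) (use le' in auto)
  show "in_Lp01 p f" using I m by (simp add: in_Lp01_iff)
  show "Lp_norm01 p f \<le> Lp_norm01 p F"
  proof (rule Lp_norm01_leI[OF p])
    show "(LINT x|lborel. \<bar>?u x\<bar> powr p) \<le> Lp_norm01 p F powr p"
      unfolding Lp_norm01_powr[OF p] by (rule integral_mono_AE[OF I F' le'])
  qed simp
qed


lemma continuous_in_Lp01:
  assumes "continuous_on {0..1} f" "p > 0"
  shows "in_Lp01 p f"
proof -
  have "continuous_on {0..1} (\<lambda>x. \<bar>f x\<bar> powr p)"
    using assms by (intro continuous_on_powr' continuous_intros) auto
  then have "set_integrable lborel {0..1} (\<lambda>x. \<bar>f x\<bar> powr p)"
    by (rule borel_integrable_atLeastAtMost')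
  moreover have "set_borel_measurable lborel {0..1} f"
    using borel_measurable_continuous_on_indicator[OF _ assms(1)]
    by (simp add: set_borel_measurable_def)
  ultimately show ?thesis by (simp add: in_Lp01_def)
qed

text \<open>The interval has finite measure, so \<open>1 + \<bar>f x\<bar> powr p\<close> is an
  integrable majorant.\<close>

lemma in_Lp01_integrable:
  assumes "p \<ge> 1" "in_Lp01 p f"
  shows "set_integrable lborel {0..1} f"
proof -
  have f: "set_borel_measurable lborel {0..1} f" "set_integrable lborel {0..1} (\<lambda>x. \<bar>f x\<bar> powr p)"
    using assms by (auto simp: in_Lp01_def)
  have "set_integrable lborel {0..1} (\<lambda>x. 1 + \<bar>f x\<bar> powr p)"
    using f(2) by (intro set_integral_add) (auto simp: set_integrable_def)
  then show ?thesis
  proof (rule set_integrable_bound[OF _ f(1)], intro AE_I2 impI)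
    fix x
    have "\<bar>f x\<bar> \<le> 1 + \<bar>f x\<bar> powr p"
    proof (cases "\<bar>f x\<bar> \<le> 1")
      case False
      then have "\<bar>f x\<bar> powr 1 \<le> \<bar>f x\<bar> powr p" using assms by (intro powr_mono) auto
      then show ?thesis using False by simp
    qed (simp add: add_increasing2)
    then show "norm (f x) \<le> norm (1 + \<bar>f x\<bar> powr p)" by simp
  qed
qed

section \<open>Absolutely continuous functions\<close>

lemma abs_cont01_finite_family:
  assumes "abs_cont01 G" and "e > 0"
  shows "\<exists>d>0. \<forall>(I :: 'i set) a b. finite I \<and> (\<forall>i\<in>I. 0 \<le> a i \<and> a i \<le> b i \<and> b i \<le> 1) \<and>
      (\<forall>i\<in>I. \<forall>j\<in>I. i \<noteq> j \<longrightarrow> b i \<le> a j \<or> b j \<le> a i) \<and>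
      (\<Sum>i\<in>I. b i - a i) < d \<longrightarrow> (\<Sum>i\<in>I. \<bar>G (b i) - G (a i)\<bar>) < e"
proof -
  have "\<exists>d>0. \<forall>(n::nat) a b.
     (\<forall>i<n. 0 \<le> a i \<and> a i \<le> b i \<and> b i \<le> 1) \<and>
     (\<forall>i<n. \<forall>j<n. i \<noteq> j \<longrightarrow> b i \<le> a j \<or> b j \<le> a i) \<and>
     (\<Sum>i<n. b i - a i) < d \<longrightarrow> (\<Sum>i<n. \<bar>G (b i) - G (a i)\<bar>) < e"
    (is "\<exists>d>0. ?P d") using assms(1)[unfolded abs_cont01_def, THEN spec, THEN mp, OF assms(2)] .
  then obtain d where d': "d > 0 \<and> ?P d" ..
  then have d: "d > 0" and *: "?P d" by (rule conjunct1, rule conjunct2)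
  show ?thesis
  proof (rule exI[of _ d], rule conjI[OF d], intro allI impI)
    fix I :: "'i set" and a b
    assume asm: "finite I \<and> (\<forall>i\<in>I. 0 \<le> a i \<and> a i \<le> b i \<and> b i \<le> 1) \<and>
      (\<forall>i\<in>I. \<forall>j\<in>I. i \<noteq> j \<longrightarrow> b i \<le> a j \<or> b j \<le> a i) \<and> (\<Sum>i\<in>I. b i - a i) < d"
    from asm have I: "finite I" "(\<Sum>i\<in>I. b i - a i) < d" by simp_all
    from asm have I2: "\<forall>i\<in>I. 0 \<le> a i \<and> a i \<le> b i \<and> b i \<le> 1"
      "\<forall>i\<in>I. \<forall>j\<in>I. i \<noteq> j \<longrightarrow> b i \<le> a j \<or> b j \<le> a i" by simp_all
    obtain h where h: "bij_betw h {..<card I} I"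
      using ex_bij_betw_nat_finite[OF I(1)] by (auto simp: atLeast0LessThan)
    have mem: "h i \<in> I" if "i < card I" for i using h that by (auto simp: bij_betw_def)
    have inj: "h i \<noteq> h j" if "i < card I" "j < card I" "i \<noteq> j" for i j
      using h that by (auto simp: bij_betw_def inj_on_def)
    have "(\<Sum>i<card I. \<bar>G ((b \<circ> h) i) - G ((a \<circ> h) i)\<bar>) < e"
    proof (rule *[THEN spec, THEN spec, THEN spec, THEN mp], intro conjI)
      show "(\<Sum>i<card I. (b \<circ> h) i - (a \<circ> h) i) < d"
        using I(2) sum.reindex_bij_betw[OF h, of "\<lambda>i. b i - a i"] by simp
    qed (use I2 mem inj in auto)
    then show "(\<Sum>i\<in>I. \<bar>G (b i) - G (a i)\<bar>) < e"
      using sum.reindex_bij_betw[OF h, of "\<lambda>i. \<bar>G (b i) - G (a i)\<bar>"] by simp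
  qed
qed

text \<open>Henstock--Kurzweil argument: the gauge forces every interval tagged in the exceptional null
  set into a small open neighbourhood of it, where absolute continuity bounds the increments of \<open>G\<close>.\<close>
lemma abs_cont01_has_integral:
  assumes ac: "abs_cont01 G"
    and deriv: "AE x in lborel. x \<in> {0..1} \<longrightarrow> (G has_real_derivative H x) (at x within {0..1})"
    and ab: "0 \<le> a" "a \<le> b" "b \<le> 1"
  shows "(H has_integral (G b - G a)) {a..b}"
proof -
  obtain N where N: "N \<in> null_sets lborel"
    and dN: "\<And>x. x \<in> {0..1} \<Longrightarrow> x \<notin> N \<Longrightarrow> (G has_real_derivative H x) (at x within {0..1})"
  proof -
    from AE_E[OF deriv] obtain N
      where "{x \<in> space lborel. \<not> (x \<in> {0..1} \<longrightarrow> (G has_real_derivative H x) (at x within {0..1}))} \<subseteq> N"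
        "emeasure lborel N = 0" "N \<in> sets lborel" by blast
    then show thesis by (intro that[of N]) (auto simp: null_sets_def)
  qed
  have negN: "negligible N" using N
    by (simp add: negligible_iff_null_sets null_sets_completionI)
  \<comment> \<open>With value 0 on \<open>N\<close>, an interval tagged there contributes nothing
    but an increment of \<open>G\<close>. The change on a negligible set is undone by
    \<open>has_integral_spike\<close>.\<close>
  define H' where "H' x = (if x \<in> N then 0 else H x)" for x
  have "(H' has_integral (G b - G a)) {a..b}"
    unfolding has_integral_real
  proof (intro allI impI)
    fix e :: real assume e: "e > 0"
    \<comment> \<open>Half of \<open>e\<close> is spent on the regular tags and half on the tags in
      \<open>N\<close>. The \<open>+ 1\<close> keeps the denominator positive when
      \<open>a = b\<close> and makes the bound strict.\<close>
    define e1 where "e1 = e / (2 * (b - a + 1))"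
    have e1: "e1 > 0" using e ab by (simp add: e1_def)
    have e1b: "e1 * (b - a) < e / 2"
    proof -
      have "e * (b - a) < e * (b - a + 1)" using e by simp
      then show ?thesis using ab by (simp add: e1_def field_simps)
    qed
    have "\<exists>d>0. \<forall>(I :: (real \<times> real set) set) a b. finite I \<and> (\<forall>i\<in>I. 0 \<le> a i \<and> a i \<le> b i \<and> b i \<le> 1) \<and>
      (\<forall>i\<in>I. \<forall>j\<in>I. i \<noteq> j \<longrightarrow> b i \<le> a j \<or> b j \<le> a i) \<and>
      (\<Sum>i\<in>I. b i - a i) < d \<longrightarrow> (\<Sum>i\<in>I. \<bar>G (b i) - G (a i)\<bar>) < e / 2"
      (is "\<exists>d>0. ?P d") using abs_cont01_finite_family[OF ac half_gt_zero[OF e]] .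
    then obtain d where d': "d > 0 \<and> ?P d" ..
    then have d: "d > 0" and dac: "?P d" by (rule conjunct1, rule conjunct2)
    obtain U where U: "open U" "N \<subseteq> U" "emeasure lborel (U - N) < ennreal d"
      using outer_regular_lborel[of N d] N d by (auto simp: null_sets_def)
    have mU: "emeasure lborel U < ennreal d"
      using U N emeasure_Diff_null_set[of N lborel U] by auto
    have "\<exists>r>0. (x \<in> N \<longrightarrow> ball x r \<subseteq> U) \<and> (x \<in> {0..1} - N \<longrightarrow>
       (\<forall>y\<in>{0..1}. \<bar>y - x\<bar> < r \<longrightarrow> \<bar>G y - G x - H x * (y - x)\<bar> \<le> e1 * \<bar>y - x\<bar>))" for x
    proof (cases "x \<in> N")
      case True
      then show ?thesis using U by (meson DiffD2 openE subsetD)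
    next
      case False
      show ?thesis
      proof (cases "x \<in> {0..1}")
        case True
        with False dN have "(G has_derivative (\<lambda>y. H x * y)) (at x within {0..1})"
          by (simp add: has_field_derivative_def)
        then obtain r where "r > 0" "\<forall>y\<in>{0..1}. norm (y - x) < r \<longrightarrow>
            norm (G y - G x - H x * (y - x)) \<le> e1 * norm (y - x)"
          unfolding has_derivative_within_alt using e1 by blast
        with False show ?thesis by auto
      qed (use False in \<open>auto intro: exI[of _ 1]\<close>)
    qed
    then obtain r where r: "\<And>x. r x > 0" "\<And>x. x \<in> N \<Longrightarrow> ball x (r x) \<subseteq> U"
      "\<And>x y. x \<in> {0..1} - N \<Longrightarrow> y \<in> {0..1} \<Longrightarrow> \<bar>y - x\<bar> < r x \<Longrightarrow>
         \<bar>G y - G x - H x * (y - x)\<bar> \<le> e1 * \<bar>y - x\<bar>"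
      by metis
    show "\<exists>\<gamma>. gauge \<gamma> \<and> (\<forall>\<D>. \<D> tagged_division_of {a..b} \<and> \<gamma> fine \<D> \<longrightarrow>
        norm ((\<Sum>(x, k)\<in>\<D>. measure lborel k *\<^sub>R H' x) - (G b - G a)) < e)"
    proof (intro exI[of _ "\<lambda>x. ball x (r x)"] conjI allI impI)
      show "gauge (\<lambda>x. ball x (r x))" using r(1) by (simp add: gauge_def)
      fix \<D> assume D: "\<D> tagged_division_of {a..b} \<and> (\<lambda>x. ball x (r x)) fine \<D>"
      have fin: "finite \<D>" using D by (blast intro: tagged_division_of_finite)
      have DD: "\<exists>u v. u \<le> v \<and> K = {u..v} \<and> Inf K = u \<and> Sup K = v \<and> measure lborel K = v - u \<and>
          u \<in> {0..1} \<and> v \<in> {0..1} \<and> x \<in> {u..v} \<and> {u..v} \<subseteq> ball x (r x)"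
        if xK: "(x, K) \<in> \<D>" for x K
      proof -
        have tag: "\<D> tagged_division_of {a..b}" using D by blast
        obtain u v where K: "K = cbox u v"
          using tagged_division_ofD(4)[OF tag xK] by blast
        have x: "x \<in> K" "K \<subseteq> {a..b}"
          using tagged_division_ofD(2,3)[OF tag xK] by auto
        have "K \<subseteq> ball x (r x)" using D xK by (auto simp: fine_def)
        moreover have "u \<le> v" "u \<in> {0..1}" "v \<in> {0..1}" using K x ab by auto
        ultimately show ?thesis using K x by (intro exI[of _ u] exI[of _ v]) auto
      qed
      define g where "g = (\<lambda>(x, K). measure lborel K * H' x - (G (Sup K) - G (Inf K)))"
      \<comment> \<open>Degenerate intervals are left out: having empty interior, they may lie
        inside another interval of the division, which would break the separation that absolute
        continuity asks for. Their terms are zero anyway.\<close>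
      define B where "B = {(x, K) \<in> \<D>. x \<in> N \<and> measure lborel K \<noteq> 0}"
      have BD: "B \<subseteq> \<D>" by (auto simp: B_def)
      then have finB: "finite B" using fin finite_subset by blast
      have good: "\<bar>g (x, K)\<bar> \<le> e1 * measure lborel K" if xK: "(x, K) \<in> \<D> - B" for x K
      proof -
        obtain u v where K: "u \<le> v" "K = {u..v}" "Inf K = u" "Sup K = v" "measure lborel K = v - u"
            "u \<in> {0..1}" "v \<in> {0..1}" "x \<in> {u..v}" "{u..v} \<subseteq> ball x (r x)" using DD xK by blast
        show ?thesis
        proof (cases "measure lborel K = 0")
          case True
          then have "u = v" using K by auto
          then show ?thesis using K True by (simp add: g_def)
        next
          case False
          then have x: "x \<in> {0..1} - N" using xK K by (auto simp: B_def)
          have "u \<in> {u..v}" "v \<in> {u..v}" using K by auto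
          then have "u \<in> ball x (r x)" "v \<in> ball x (r x)" using K(9) by blast+
          then have "\<bar>u - x\<bar> < r x" "\<bar>v - x\<bar> < r x" by (auto simp: dist_real_def)
          then have *: "\<bar>G u - G x - H x * (u - x)\<bar> \<le> e1 * \<bar>u - x\<bar>"
               "\<bar>G v - G x - H x * (v - x)\<bar> \<le> e1 * \<bar>v - x\<bar>"
            using r(3)[OF x] K(6,7) by blast+
          \<comment> \<open>The error on \<open>K\<close> is the difference of two linearisation
            errors at the tag. As the tag lies between \<open>u\<close> and \<open>v\<close>, the
            two distances add up to the length of \<open>K\<close>.\<close>
          have "g (x, K) = (G u - G x - H x * (u - x)) - (G v - G x - H x * (v - x))"
            using K x by (simp add: g_def H'_def algebra_simps)
          also have "\<bar>\<dots>\<bar> \<le> e1 * \<bar>u - x\<bar> + e1 * \<bar>v - x\<bar>" using * by linarith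
          also have "\<dots> = e1 * measure lborel K" using K by (simp add: algebra_simps)
          finally show ?thesis .
        qed
      qed
      have "(\<Sum>i\<in>\<D> - B. \<bar>g i\<bar>) \<le> (\<Sum>(x, K)\<in>\<D> - B. e1 * measure lborel K)"
        using good by (intro sum_mono) auto
      also have "\<dots> \<le> (\<Sum>(x, K)\<in>\<D>. e1 * measure lborel K)"
        using fin e1 by (intro sum_mono2) (auto simp: case_prod_beta intro!: mult_nonneg_nonneg)
      also have "\<dots> = e1 * (\<Sum>(x, K)\<in>\<D>. measure lborel K)"
        by (simp add: sum_distrib_left case_prod_beta)
      also have "(\<Sum>(x, K)\<in>\<D>. measure lborel K) = b - a"
        using additive_content_tagged_division[of \<D> a b] D ab by (simp add: box_real)
      finally have sg: "(\<Sum>i\<in>\<D> - B. \<bar>g i\<bar>) < e / 2" using e1b by simp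
      have dist: "Sup (snd i) \<le> Inf (snd j) \<or> Sup (snd j) \<le> Inf (snd i)"
        if ij: "i \<in> B" "j \<in> B" "i \<noteq> j" for i j
      proof -
        obtain x K where i: "i = (x, K)" by force
        obtain y L where j: "j = (y, L)" by force
        obtain u v where K: "u \<le> v" "K = {u..v}" "Inf K = u" "Sup K = v" "measure lborel K = v - u"
          using DD[of x K] ij(1) BD i by blast
        obtain s t where L: "s \<le> t" "L = {s..t}" "Inf L = s" "Sup L = t" "measure lborel L = t - s"
          using DD[of y L] ij(2) BD j by blast
        have uv: "u < v" "s < t" using K L ij i j by (auto simp: B_def)
        have "interior K \<inter> interior L = {}"
          using D ij i j BD tagged_division_ofD(5)[of \<D> "{a..b}" x K y L] by blast
        then have dj: "{u<..<v} \<inter> {s<..<t} = {}" using K L by simp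
        have "v \<le> s \<or> t \<le> u"
        proof (rule ccontr)
          assume "\<not> (v \<le> s \<or> t \<le> u)"
          then have "(max u s + min v t) / 2 \<in> {u<..<v} \<inter> {s<..<t}" using uv by auto
          with dj show False by blast
        qed
        then show ?thesis using K L i j by simp
      qed
      have len: "(\<Sum>i\<in>B. Sup (snd i) - Inf (snd i)) < d"
      proof -
        \<comment> \<open>Open intervals, because neighbouring closed ones share an endpoint and
          would not be disjoint.\<close>
        let ?J = "\<lambda>i :: real \<times> real set. {Inf (snd i)<..<Sup (snd i)}"
        have le: "Inf (snd i) \<le> Sup (snd i)" "?J i \<subseteq> U" if iB: "i \<in> B" for i
        proof -
          obtain x K where i: "i = (x, K)" by force
          obtain u v where K: "u \<le> v" "K = {u..v}" "Inf K = u" "Sup K = v" "{u..v} \<subseteq> ball x (r x)"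
            using DD[of x K] iB BD i by blast
          have "ball x (r x) \<subseteq> U" using iB i r(2) by (auto simp: B_def)
          with K(5) have "{u..v} \<subseteq> U" by blast
          moreover have "{u<..<v} \<subseteq> {u..v}" by auto
          ultimately have "{u<..<v} \<subseteq> U" by blast
          with K(1-4) i show "Inf (snd i) \<le> Sup (snd i)" "?J i \<subseteq> U" by auto
        qed
        have "ennreal (\<Sum>i\<in>B. Sup (snd i) - Inf (snd i)) = (\<Sum>i\<in>B. emeasure lborel (?J i))"
          using le by (subst sum_ennreal[symmetric]) auto
        also have "\<dots> = emeasure lborel (\<Union>i\<in>B. ?J i)"
        proof (intro sum_emeasure finB)
          show "disjoint_family_on ?J B"
            unfolding disjoint_family_on_def
          proof (intro ballI impI)
            fix i j assume "i \<in> B" "j \<in> B" "i \<noteq> j"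
            from dist[OF this] show "?J i \<inter> ?J j = {}" by auto
          qed
        qed auto
        also have "\<dots> \<le> emeasure lborel U" using le(2) U(1) by (intro emeasure_mono UN_least) auto
        finally have "ennreal (\<Sum>i\<in>B. Sup (snd i) - Inf (snd i)) < ennreal d" using mU by simp
        then show ?thesis using d le(1) by (subst (asm) ennreal_less_iff) (auto intro!: sum_nonneg)
      qed
      have "(\<Sum>i\<in>B. \<bar>G (Sup (snd i)) - G (Inf (snd i))\<bar>) < e / 2"
      proof (rule dac[THEN spec, THEN spec, THEN spec, THEN mp], intro conjI ballI impI dist len finB)
        fix i assume "i \<in> B"
        then have "(fst i, snd i) \<in> \<D>" using BD by auto
        from DD[OF this] show "0 \<le> Inf (snd i)" "Inf (snd i) \<le> Sup (snd i)" "Sup (snd i) \<le> 1" by force+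
      qed auto
      also have "(\<Sum>i\<in>B. \<bar>G (Sup (snd i)) - G (Inf (snd i))\<bar>) = (\<Sum>i\<in>B. \<bar>g i\<bar>)"
        by (intro sum.cong) (auto simp: g_def B_def H'_def)
      finally have sb: "(\<Sum>i\<in>B. \<bar>g i\<bar>) < e / 2" .
      have "(\<Sum>(x, k)\<in>\<D>. measure lborel k *\<^sub>R H' x) - (G b - G a)
          = (\<Sum>(x, K)\<in>\<D>. measure lborel K * H' x) - (\<Sum>(x, K)\<in>\<D>. G (Sup K) - G (Inf K))"
        using additive_tagged_division_1[of a b \<D> G] D ab by simp
      also have "\<dots> = (\<Sum>i\<in>\<D>. g i)"
        by (simp add: g_def sum_subtractf case_prod_beta)
      also have "\<bar>\<dots>\<bar> \<le> (\<Sum>i\<in>\<D>. \<bar>g i\<bar>)" by (rule sum_abs)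
      also have "\<dots> = (\<Sum>i\<in>\<D> - B. \<bar>g i\<bar>) + (\<Sum>i\<in>B. \<bar>g i\<bar>)"
        using sum.subset_diff[OF BD fin] .
      also have "\<dots> < e" using sg sb by simp
      finally show "norm ((\<Sum>(x, k)\<in>\<D>. measure lborel k *\<^sub>R H' x) - (G b - G a)) < e" by simp
    qed
  qed
  moreover have "\<And>x. x \<in> {a..b} - N \<Longrightarrow> H x = H' x" by (simp add: H'_def)
  ultimately show ?thesis using has_integral_spike[OF negN] by blast
qed

section \<open>Bernstein basis functions and the nodes\<close>

lemma bern_eq_Bernstein: "bern = Bernstein"
  by (intro ext) (simp add: bern_def Bernstein_def)

lemma bern_nonneg: "0 \<le> y \<Longrightarrow> y \<le> 1 \<Longrightarrow> 0 \<le> bern n k y"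
  by (simp add: bern_eq_Bernstein Bernstein_nonneg)

lemma sum_bern: "(\<Sum>k\<le>n. bern n k y) = 1"
  by (simp add: bern_eq_Bernstein)

text \<open>The variance of a binomial mean. The square is expanded in the factorial moments
  \<open>k * (k - 1)\<close>, \<open>k\<close> and \<open>1\<close>, whose Bernstein sums are
  known.\<close>

lemma sum_bern_square_dev:
  assumes "n > 0"
  shows "(\<Sum>k\<le>n. bern n k y * (real k / real n - y)\<^sup>2) = y * (1 - y) / real n"
proof -
  have *: "Bernstein n k y * (real k - n * y)\<^sup>2 = real k * (real k - 1) * Bernstein n k y
      + (1 - 2 * (n * y)) * (real k * Bernstein n k y) + (n * y)\<^sup>2 * Bernstein n k y" for k
    by (simp add: algebra_simps power2_eq_square)
  have "(\<Sum>k\<le>n. Bernstein n k y * (real k - n * y)\<^sup>2) = real n * y * (1 - y)"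
    unfolding * sum.distrib sum_distrib_left[symmetric] sum_k_Bernstein sum_kk_Bernstein sum_Bernstein
    by (simp add: algebra_simps power2_eq_square)
  moreover have "(real k / real n - y)\<^sup>2 = (real k - n * y)\<^sup>2 / (real n)\<^sup>2" for k
  proof -
    have "real k / real n - y = (real k - n * y) / real n" using assms by (simp add: diff_divide_distrib)
    then show ?thesis by (simp only: power_divide)
  qed
  ultimately have "(\<Sum>k\<le>n. Bernstein n k y * (real k / real n - y)\<^sup>2) = real n * y * (1 - y) / (real n)\<^sup>2"
    by (simp add: sum_divide_distrib[symmetric])
  then show ?thesis using assms by (simp add: bern_eq_Bernstein power2_eq_square)
qed

text \<open>Instead of Cauchy-Schwarz, the pointwise bound
  \<open>\<bar>d\<bar> \<le> r * d\<^sup>2 + 1 / (4 * r)\<close> reduces the claim to the variance.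
  The choice \<open>r = sqrt n\<close> balances the two terms, each becoming at most
  \<open>1 / (4 * r)\<close> since \<open>y * (1 - y) \<le> 1 / 4\<close>.\<close>

lemma sum_bern_abs_dev:
  assumes "n > 0" "0 \<le> y" "y \<le> 1"
  shows "(\<Sum>k\<le>n. bern n k y * \<bar>real k / real n - y\<bar>) \<le> 1 / (2 * sqrt (real n))"
proof -
  define r where "r = sqrt (real n)"
  have r: "r > 0" "r * r = real n" using assms by (auto simp: r_def)
  have amgm: "\<bar>d\<bar> \<le> r * d\<^sup>2 + 1 / (4 * r)" for d :: real
  proof -
    have "0 \<le> (2 * r * \<bar>d\<bar> - 1)\<^sup>2 / (4 * r)" using r by simp
    also have "\<dots> = r * d\<^sup>2 + 1 / (4 * r) - \<bar>d\<bar>"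
      using r by (simp add: field_simps power2_eq_square)
    finally show ?thesis by simp
  qed
  have "(\<Sum>k\<le>n. bern n k y * \<bar>real k / real n - y\<bar>)
      \<le> (\<Sum>k\<le>n. bern n k y * (r * (real k / real n - y)\<^sup>2 + 1 / (4 * r)))"
    using assms by (intro sum_mono mult_left_mono amgm bern_nonneg)
  also have "\<dots> = (\<Sum>k\<le>n. r * (bern n k y * (real k / real n - y)\<^sup>2) + (1 / (4 * r)) * bern n k y)"
    by (intro sum.cong) (auto simp: algebra_simps)
  also have "\<dots> = r * (y * (1 - y) / real n) + 1 / (4 * r)"
    unfolding sum.distrib sum_distrib_left[symmetric] sum_bern sum_bern_square_dev[OF assms(1)] by simp
  also have "y * (1 - y) \<le> 1 / 4"
  proof -
    have "0 \<le> (y - 1 / 2)\<^sup>2" by simp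
    then show ?thesis by (simp add: power2_eq_square algebra_simps)
  qed
  then have "r * (y * (1 - y) / real n) \<le> r * (1 / 4 / real n)"
    using r assms by (intro mult_left_mono divide_right_mono) auto
  also have "\<dots> = 1 / (4 * r)" using r by (simp add: r(2)[symmetric])
  finally show ?thesis by (simp add: r_def)
qed

section \<open>Antiderivatives of the Bernstein basis functions\<close>

lemma has_real_derivative_bern:
  "(bern (Suc n) (Suc j) has_real_derivative real (Suc n) * (bern n j y - bern n (Suc j) y)) (at y)"
proof -
  have c1: "real (Suc n choose Suc j) * real (Suc j) = real (Suc n) * real (n choose j)"
    by (metis Suc_times_binomial of_nat_mult mult.commute)
  have c2: "real (Suc n choose Suc j) * real (n - j) = real (Suc n) * real (n choose Suc j)"
    by (metis binomial_absorb_comp of_nat_mult mult.commute diff_Suc_Suc diff_Suc_1)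
  have "(bern (Suc n) (Suc j) has_real_derivative
      real (Suc n choose Suc j) * real (Suc j) * y ^ j * (1 - y) ^ (n - j)
      - real (Suc n choose Suc j) * real (n - j) * y ^ Suc j * (1 - y) ^ (n - Suc j)) (at y)"
    unfolding bern_def[abs_def]
    by (auto intro!: derivative_eq_intros simp: algebra_simps simp del: power_Suc)
  then show ?thesis unfolding c1 c2 by (simp add: bern_def algebra_simps)
qed

text \<open>The derivatives telescope from \<open>k\<close> upwards, and the last term
  \<open>bern n (Suc n)\<close> is zero. The antiderivative runs from 0 to
  \<open>1 / (n + 1)\<close> on the unit interval, because at 1 only the summand
  \<open>j = n\<close> survives.\<close>

lemma bern_antiderivative:
  assumes "k \<le> n"
  shows "((\<lambda>y. (\<Sum>j=k..n. bern (Suc n) (Suc j) y) / real (Suc n)) has_real_derivative bern n k y) (at y)"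
proof -
  have "(\<Sum>j=k..n. bern n j y - bern n (Suc j) y) = bern n k y - bern n (Suc n) y"
    using sum_Suc_diff[of k n "\<lambda>j. - bern n j y"] assms by simp
  then have eq: "(\<Sum>j=k..n. real (Suc n) * (bern n j y - bern n (Suc j) y)) / real (Suc n) = bern n k y"
    by (simp add: sum_distrib_left[symmetric] bern_def binomial_eq_0 del: of_nat_Suc)
  show ?thesis
    by (rule DERIV_cong[OF DERIV_cdivide[OF DERIV_sum[OF has_real_derivative_bern]] eq])
qed

lemma sum_bern_at_0: "(\<Sum>j=k..n. bern (Suc n) (Suc j) 0) = 0"
  by (simp add: bern_def)

lemma sum_bern_at_1:
  assumes "k \<le> n" shows "(\<Sum>j=k..n. bern (Suc n) (Suc j) 1) = 1"
proof -
  have "(\<Sum>j=k..n. bern (Suc n) (Suc j) 1) = (\<Sum>j=k..n. if j = n then 1 else 0)"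
    by (intro sum.cong) (auto simp: bern_def power_0_left)
  then show ?thesis using assms by simp
qed

section \<open>The nodes as a normalised logarithm\<close>

context
  fixes \<mu> :: real and m :: nat
  assumes mu: "\<mu> > 0" and m: "m > 0"
begin

definition "a_step = 1 / (real m * (1 + \<mu>))"

lemma a_step_pos: "a_step > 0" using mu m by (simp add: a_step_def)

lemma a_step_le: "a_step \<le> 1 / real m" "1 + a_step \<le> K_mu \<mu>"
proof -
  have "real m * 1 \<le> real m * (1 + \<mu>)" "1 * (1 + \<mu>) \<le> real m * (1 + \<mu>)" 
    using mu m by (intro mult_left_mono mult_right_mono; simp)+
  then show "a_step \<le> 1 / real m" "1 + a_step \<le> K_mu \<mu>"
    unfolding a_step_def K_mu_def using mu m by (auto intro!: divide_left_mono)
qed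

lemma a_seq_eq: "a_seq \<mu> m x = ln (1 + a_step * x) / ln (1 + a_step)"
  by (simp add: a_seq_def a_step_def)

lemma ln_a_step: "0 < ln (1 + a_step)" "ln (1 + a_step) \<le> a_step" "a_step / (1 + a_step) \<le> ln (1 + a_step)"
proof -
  show "0 < ln (1 + a_step)" using a_step_pos by simp
  show "ln (1 + a_step) \<le> a_step" using a_step_pos by (intro ln_add_one_self_le_self) auto
  have "ln (1 / (1 + a_step)) \<le> 1 / (1 + a_step) - 1" using a_step_pos by (intro ln_le_minus_one) auto
  moreover have "1 / (1 + a_step) - 1 = - (a_step / (1 + a_step))" using a_step_pos by (simp add: field_simps)
  ultimately show "a_step / (1 + a_step) \<le> ln (1 + a_step)" using a_step_pos by (simp add: ln_div)
qed

lemma a_seq_0 [simp]: "a_seq \<mu> m 0 = 0" and a_seq_1 [simp]: "a_seq \<mu> m 1 = 1"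
  using ln_a_step by (simp_all add: a_seq_eq)

lemma a_seq_bounds:
  assumes "0 \<le> x" "x \<le> 1" shows "0 \<le> a_seq \<mu> m x" "a_seq \<mu> m x \<le> 1"
proof -
  have "0 \<le> a_step * x" "a_step * x \<le> a_step * 1" using assms a_step_pos by (auto intro!: mult_left_mono)
  then show "0 \<le> a_seq \<mu> m x" "a_seq \<mu> m x \<le> 1"
    unfolding a_seq_eq using ln_a_step(1) a_step_pos by auto
qed

lemma a_seq_deriv:
  assumes "0 \<le> x"
  shows "(a_seq \<mu> m has_real_derivative a_step / ((1 + a_step * x) * ln (1 + a_step))) (at x within S)"
proof -
  have "1 + a_step * x > 0" using assms a_step_pos by (simp add: add_pos_nonneg)
  then have "((\<lambda>x. ln (1 + a_step * x)) has_real_derivative a_step / (1 + a_step * x)) (at x within S)"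
    by (auto intro!: derivative_eq_intros)
  from DERIV_cdivide[OF this, of "ln (1 + a_step)"] show ?thesis
    unfolding a_seq_eq[abs_def] by simp
qed

text \<open>Follows from \<open>1 + a_step * x \<le> 1 + a_step \<le> K_mu \<mu>\<close> and
  \<open>ln (1 + a_step) \<le> a_step\<close>. It allows the factor \<open>K_mu \<mu>\<close> times
  the derivative of the nodes to be inserted into an integral of a nonnegative function, which turns
  the composition with the nodes into an exact substitution.\<close>

lemma a_seq_deriv_ge:
  assumes "0 \<le> x" "x \<le> 1"
  shows "1 \<le> K_mu \<mu> * (a_step / ((1 + a_step * x) * ln (1 + a_step)))"
proof -
  have x: "0 \<le> a_step * x" "a_step * x \<le> a_step * 1" using assms a_step_pos by (auto intro!: mult_left_mono)
  have "1 + a_step * x \<le> K_mu \<mu>" using x a_step_le(2) by linarith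
  moreover have "0 \<le> K_mu \<mu>" using a_step_le(2) a_step_pos by linarith
  ultimately have "(1 + a_step * x) * ln (1 + a_step) \<le> K_mu \<mu> * a_step"
    by (rule mult_mono[OF _ ln_a_step(2)]) (use ln_a_step(1) in simp)
  moreover have "(1 + a_step * x) * ln (1 + a_step) > 0" using x ln_a_step(1) by simp
  ultimately show ?thesis by simp
qed

lemma continuous_on_a_seq: "continuous_on {0..1} (a_seq \<mu> m)"
  by (meson DERIV_continuous_on a_seq_deriv atLeastAtMost_iff)

text \<open>Concavity of \<open>ln\<close> puts the node above \<open>x\<close>; the elementary
  lower bound \<open>a_step / (1 + a_step)\<close> for the normalising logarithm limits the excess
  to \<open>a_step * x\<close>.\<close>

lemma a_seq_dev:
  assumes "0 \<le> x" "x \<le> 1"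
  shows "\<bar>a_seq \<mu> m x - x\<bar> \<le> 1 / real m"
proof -
  have x: "0 \<le> a_step * x" "a_step * x \<le> a_step * 1" using assms a_step_pos by (auto intro!: mult_left_mono)
  have "x * ln (1 + a_step) \<le> ln (1 + a_step * x)"
  proof -
    have "ln ((1 - x) * 1 + x * (1 + a_step)) \<ge> (1 - x) * ln 1 + x * ln (1 + a_step)"
      using concave_onD[OF ln_concave, of x 1 "1 + a_step"] assms a_step_pos by simp
    then show ?thesis by (simp add: algebra_simps)
  qed
  then have lo: "x \<le> a_seq \<mu> m x" using ln_a_step(1) by (simp add: a_seq_eq pos_le_divide_eq)
  have "ln (1 + a_step * x) \<le> a_step * x" using x by (intro ln_add_one_self_le_self)
  \<comment> \<open>Rewritten so that the factor \<open>a_step / (1 + a_step)\<close>, which bounds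
    \<open>ln (1 + a_step)\<close> from below, appears.\<close>
  also have "\<dots> = (x + a_step * x) * (a_step / (1 + a_step))" using a_step_pos by (simp add: field_simps)
  also have "\<dots> \<le> (x + a_step * x) * ln (1 + a_step)" using x assms ln_a_step by (intro mult_left_mono) auto
  finally have "a_seq \<mu> m x \<le> x + a_step * x" using ln_a_step(1) by (simp add: a_seq_eq pos_divide_le_eq)
  then show ?thesis using lo x a_step_le by simp
qed

end

text \<open>A supremum of reals dominates its members only if they are bounded above, which
  \<open>a_seq_dev\<close> guarantees. The case \<open>x = 0\<close> later gives the sign of
  \<open>gamma_n\<close>.\<close>

lemma a_seq_dev_le_gamma_n:
  assumes "\<mu> > 0" "0 \<le> x" "x \<le> 1"
  shows "\<bar>a_seq \<mu> (n + 1) x - x\<bar> \<le> gamma_n \<mu> n"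
  unfolding gamma_n_def
proof (rule cSUP_upper)
  have "\<bar>a_seq \<mu> (n + 1) y - y\<bar> \<le> 1 / real (n + 1)" if "y \<in> {0..1}" for y
    using a_seq_dev[OF assms(1), of "n + 1" y] that by simp
  then show "bdd_above ((\<lambda>y. \<bar>a_seq \<mu> (n + 1) y - y\<bar>) ` {0..1})" by (rule bdd_aboveI2)
qed (use assms in simp)

lemma continuous_on_bern_a_seq:
  assumes "\<mu> > 0"
  shows "continuous_on {0..1} (\<lambda>x. bern n k (a_seq \<mu> (n + 1) x))"
  unfolding bern_def using assms by (intro continuous_intros continuous_on_a_seq) auto

text \<open>The integrand is enlarged by \<open>K_mu \<mu>\<close> times the derivative of the
  nodes. Since the nodes map 0 to 0 and 1 to 1, the substitution then yields the full integral
  \<open>1 / (n + 1)\<close> of the basis function.\<close>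

lemma integral_bern_a_seq:
  assumes mu: "\<mu> > 0" and k: "k \<le> n"
  shows "(LINT x:{0..1}|lborel. bern n k (a_seq \<mu> (n + 1) x)) \<le> K_mu \<mu> / real (n + 1)"
proof -
  let ?a = "a_seq \<mu> (n + 1)"
  let ?d = "\<lambda>x. a_step \<mu> (n + 1) / ((1 + a_step \<mu> (n + 1) * x) * ln (1 + a_step \<mu> (n + 1)))"
  let ?B = "\<lambda>y. (\<Sum>j=k..n. bern (Suc n) (Suc j) y) / real (Suc n)"
  have n1: "n + 1 > 0" by simp
  have cont: "continuous_on {0..1} (\<lambda>x. bern n k (?a x))" by (rule continuous_on_bern_a_seq[OF mu])
  have "((\<lambda>x. bern n k (?a x) * ?d x) has_integral ?B (?a 1) - ?B (?a 0)) {0..1}"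
  proof (rule fundamental_theorem_of_calculus)
    fix x :: real assume "x \<in> {0..1}"
    then have "(?a has_real_derivative ?d x) (at x within {0..1})"
      using a_seq_deriv[OF mu n1] by simp
    from DERIV_chain2[OF bern_antiderivative[OF k] this]
    show "((\<lambda>x. ?B (?a x)) has_vector_derivative bern n k (?a x) * ?d x) (at x within {0..1})"
      by (simp add: has_real_derivative_iff_has_vector_derivative)
  qed simp
  then have "((\<lambda>x. K_mu \<mu> * (bern n k (?a x) * ?d x)) has_integral K_mu \<mu> * (1 / real (n + 1))) {0..1}"
    using a_seq_0[OF mu n1] a_seq_1[OF mu n1] sum_bern_at_0 sum_bern_at_1[OF k]
    by (intro has_integral_mult_right) simp
  moreover have int: "((\<lambda>x. bern n k (?a x)) has_integral integral {0..1} (\<lambda>x. bern n k (?a x))) {0..1}"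
    using cont by (intro integrable_integral integrable_continuous_interval)
  moreover have "bern n k (?a x) \<le> K_mu \<mu> * (bern n k (?a x) * ?d x)" if "x \<in> {0..1}" for x
  proof -
    have "bern n k (?a x) * 1 \<le> bern n k (?a x) * (K_mu \<mu> * ?d x)"
      using that a_seq_deriv_ge[OF mu n1] a_seq_bounds[OF mu n1]
      by (intro mult_left_mono bern_nonneg) auto
    then show ?thesis by (simp add: mult_ac)
  qed
  ultimately have "integral {0..1} (\<lambda>x. bern n k (?a x)) \<le> K_mu \<mu> * (1 / real (n + 1))"
    by (metis (no_types, lifting) has_integral_le)
  then show ?thesis
    using set_borel_integral_eq_integral(2)[OF borel_integrable_atLeastAtMost'[OF cont]] by simp
qed

section \<open>The Kantorovich operator on L^p\<close>

text \<open>The cells are open so that they are disjoint and avoid \<open>0\<close>, which \<open>maxfun\<close> does not sample.\<close>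
definition cell :: "nat \<Rightarrow> nat \<Rightarrow> real set" where
  "cell n k = {real k / real (n + 1)<..<real (k + 1) / real (n + 1)}"

text \<open>The mean value of \<open>F\<close> over a cell, whose length is
  \<open>1 / (n + 1)\<close>.\<close>

definition avg :: "nat \<Rightarrow> nat \<Rightarrow> (real \<Rightarrow> real) \<Rightarrow> real" where
  "avg n k F = real (n + 1) * (LINT t:cell n k|lborel. F t)"

lemma cell_subset:
  assumes "k \<le> n" shows "cell n k \<subseteq> {0<..1}" "cell n k \<subseteq> {0..1}"
proof -
  have "0 \<le> real k / real (n + 1)" "real (k + 1) / real (n + 1) \<le> 1"
    using assms by (auto simp: divide_le_eq)
  then have "0 < t \<and> t \<le> 1" if "t \<in> cell n k" for t
    using that unfolding cell_def greaterThanLessThan_iff by linarith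
  then show "cell n k \<subseteq> {0<..1}" "cell n k \<subseteq> {0..1}" by force+
qed

lemma sets_cell [measurable, simp]: "cell n k \<in> sets borel"
  by (simp add: cell_def)

lemma measure_cell: "measure lborel (cell n k) = 1 / real (n + 1)"
proof -
  have "real k / real (n + 1) \<le> real (k + 1) / real (n + 1)" by (intro divide_right_mono) auto
  then show ?thesis unfolding cell_def
    by (simp add: diff_divide_distrib[symmetric])
qed

lemma finite_measure_cell: "emeasure lborel (cell n k) < \<infinity>"
proof -
  have "emeasure lborel (cell n k) \<le> emeasure lborel {real k / real (n + 1)..real (k + 1) / real (n + 1)}"
    unfolding cell_def by (intro emeasure_mono) auto
  also have "\<dots> < \<infinity>" by (simp add: emeasure_lborel_Icc_eq)
  finally show ?thesis .
qed

lemma cell_integrable: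
  fixes F :: "real \<Rightarrow> real"
  assumes "k \<le> n" "set_integrable lborel {0..1} F"
  shows "set_integrable lborel (cell n k) F"
  using assms(2) by (rule set_integrable_subset) (use cell_subset[OF assms(1)] in auto)

lemma cell_integrable_const [simp]: "set_integrable lborel (cell n k) (\<lambda>_. c)"
  using finite_measure_cell by (simp add: set_integrable_def)

lemma avg_const [simp]: "avg n k (\<lambda>_. c) = c"
  by (simp add: avg_def set_lebesgue_integral_def measure_cell)

lemma avg_add:
  assumes "set_integrable lborel (cell n k) F" "set_integrable lborel (cell n k) G"
  shows "avg n k (\<lambda>t. F t + G t) = avg n k F + avg n k G"
  using set_integral_add(2)[OF assms] by (simp add: avg_def distrib_left)

lemma avg_diff:
  assumes "set_integrable lborel (cell n k) F" "set_integrable lborel (cell n k) G"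
  shows "avg n k (\<lambda>t. F t - G t) = avg n k F - avg n k G"
  using set_integral_diff(2)[OF assms] by (simp add: avg_def right_diff_distrib)

lemma avg_cmult: "avg n k (\<lambda>t. c * F t) = c * avg n k F"
  by (simp add: avg_def)

lemma avg_mono:
  assumes "set_integrable lborel (cell n k) F" "set_integrable lborel (cell n k) G"
    "\<And>t. t \<in> cell n k \<Longrightarrow> F t \<le> G t"
  shows "avg n k F \<le> avg n k G"
  unfolding avg_def by (intro mult_left_mono set_integral_mono assms) auto

lemma avg_abs:
  assumes "set_integrable lborel (cell n k) F"
  shows "\<bar>avg n k F\<bar> \<le> avg n k (\<lambda>t. \<bar>F t\<bar>)"
proof -
  have a: "set_integrable lborel (cell n k) (\<lambda>t. \<bar>F t\<bar>)" using assms by (rule set_integrable_abs)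
  have "avg n k F \<le> avg n k (\<lambda>t. \<bar>F t\<bar>)" using assms a by (rule avg_mono) simp
  moreover have "avg n k (\<lambda>t. -1 * F t) \<le> avg n k (\<lambda>t. \<bar>F t\<bar>)"
    using assms by (intro avg_mono a set_integrable_mult_right) auto
  ultimately show ?thesis by (simp only: avg_cmult)
qed

text \<open>Jensen's inequality for the cell mean, again by averaging the tangent at the
  mean.\<close>

lemma avg_powr:
  assumes p: "p > 1" and int: "set_integrable lborel (cell n k) (\<lambda>t. \<bar>u t\<bar>)"
    "set_integrable lborel (cell n k) (\<lambda>t. \<bar>u t\<bar> powr p)"
  shows "avg n k (\<lambda>t. \<bar>u t\<bar>) powr p \<le> avg n k (\<lambda>t. \<bar>u t\<bar> powr p)"
proof -
  define m where "m = avg n k (\<lambda>t. \<bar>u t\<bar>)"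
  define B where "B = p * m powr (p - 1)"
  have "avg n k (\<lambda>_. 0) \<le> m" unfolding m_def by (intro avg_mono int) auto
  then have m: "m \<ge> 0" by simp
  have i: "set_integrable lborel (cell n k) (\<lambda>t. B * \<bar>u t\<bar>)" using int by simp
  have "avg n k (\<lambda>t. (m powr p - B * m) + B * \<bar>u t\<bar>) \<le> avg n k (\<lambda>t. \<bar>u t\<bar> powr p)"
  proof (intro avg_mono set_integral_add cell_integrable_const i int)
    fix t
    show "(m powr p - B * m) + B * \<bar>u t\<bar> \<le> \<bar>u t\<bar> powr p"
      using powr_tangent_le[OF p abs_ge_zero m, of "u t"] by (simp add: B_def right_diff_distrib)
  qed
  also have "avg n k (\<lambda>t. (m powr p - B * m) + B * \<bar>u t\<bar>) = m powr p"
    by (simp only: avg_add[OF cell_integrable_const i] avg_const avg_cmult m_def)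
  finally show ?thesis by (simp add: m_def)
qed

lemma disjoint_cells: "k \<noteq> l \<Longrightarrow> cell n k \<inter> cell n l = {}"
proof (induction k l rule: linorder_wlog)
  case (le k l)
  then have "real (k + 1) / real (n + 1) \<le> real l / real (n + 1)"
    by (intro divide_right_mono) auto
  then show ?case by (auto simp: cell_def)
next
  case (sym k l)
  then show ?case by blast
qed

text \<open>Disjointness makes the sum of the cell indicators the indicator of their union, which
  lies in the unit interval. For nonnegative \<open>F\<close> this inclusion suffices, although the
  open cells miss the division points.\<close>

lemma sum_avg_le:
  assumes "set_integrable lborel {0..1} F" "\<And>x. F x \<ge> 0"
  shows "(\<Sum>k\<le>n. avg n k F) \<le> real (n + 1) * (LINT t:{0..1}|lborel. F t)"
proof -
  have i: "integrable lborel (\<lambda>t. indicator (cell n k) t *\<^sub>R F t)" if "k \<in> {..n}" for k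
    using cell_integrable[OF _ assms(1), of k n] that by (simp add: set_integrable_def)
  have "(\<Sum>k\<le>n. LINT t:cell n k|lborel. F t) = (LINT t|lborel. (\<Sum>k\<le>n. indicator (cell n k) t *\<^sub>R F t))"
    unfolding set_lebesgue_integral_def using i by (intro Bochner_Integration.integral_sum[symmetric])
  also have "\<dots> \<le> (LINT t|lborel. indicator {0..1} t *\<^sub>R F t)"
  proof (rule integral_mono)
    show "integrable lborel (\<lambda>t. \<Sum>k\<le>n. indicator (cell n k) t *\<^sub>R F t)"
      using i by (rule Bochner_Integration.integrable_sum)
    show "integrable lborel (\<lambda>t. indicator {0..1} t *\<^sub>R F t)"
      using assms(1) by (simp add: set_integrable_def)
    fix t
    have "(\<Sum>k\<le>n. indicator (cell n k) t :: real) = indicator (\<Union>k\<le>n. cell n k) t"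
      using disjoint_cells
      by (intro indicator_UN_disjoint[symmetric]) (auto simp: disjoint_family_on_def)
    also have "\<dots> \<le> indicator {0..1} t"
    proof (cases "t \<in> (\<Union>k\<le>n. cell n k)")
      case True
      then have "t \<in> {0..1}" using cell_subset(2)[of _ n] by blast
      with True show ?thesis by simp
    qed (simp add: indicator_def)
    finally show "(\<Sum>k\<le>n. indicator (cell n k) t *\<^sub>R F t) \<le> indicator {0..1} t *\<^sub>R F t"
      using assms(2) by (simp add: sum_distrib_right[symmetric] mult_right_mono)
  qed
  finally show ?thesis
    unfolding avg_def sum_distrib_left[symmetric] set_lebesgue_integral_def[of lborel "{0..1}"]
    by (intro mult_left_mono) auto
qed

section \<open>The operator in terms of cell means, and its norm\<close>

lemma LK_eq: "LK \<mu> n f x = ln_mu \<mu> x * (\<Sum>k\<le>n. bern n k (a_seq \<mu> (n + 1) x) * avg n k (f_mu \<mu> f))"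
proof -
  have "real k / real (n + 1) \<le> real (k + 1) / real (n + 1)" for k by (intro divide_right_mono) auto
  then show ?thesis
    unfolding LK_def avg_def cell_def by (simp add: interval_integral_Ioo mult.assoc)
qed

lemma ln_mu_bounds:
  assumes "\<mu> > 0" "0 \<le> x" "x \<le> 1"
  shows "ln (1 + \<mu>) \<le> ln_mu \<mu> x" "ln_mu \<mu> x \<le> ln (2 + \<mu>)" "0 < ln_mu \<mu> x"
  using assms by (auto simp: ln_mu_def)

lemma abs_f_mu_le:
  assumes "\<mu> > 0" "0 \<le> x" "x \<le> 1"
  shows "\<bar>f_mu \<mu> f x\<bar> \<le> (1 / ln (1 + \<mu>)) * \<bar>f x\<bar>"
  unfolding f_mu_def using ln_mu_bounds[OF assms] assms(1)
  by (simp add: abs_div divide_left_mono)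

lemma set_borel_measurable_f_mu:
  assumes "set_borel_measurable lborel {0..1} f"
  shows "set_borel_measurable lborel {0..1} (f_mu \<mu> f)"
proof -
  have m [measurable]: "(\<lambda>x. indicator {0..1} x *\<^sub>R f x) \<in> borel_measurable lborel"
    using assms by (simp add: set_borel_measurable_def)
  have "(\<lambda>x. indicator {0..1} x *\<^sub>R f x / ln (1 + \<mu> + x)) \<in> borel_measurable lborel"
    by measurable
  then show ?thesis by (simp add: set_borel_measurable_def f_mu_def ln_mu_def)
qed

lemma set_integrable_f_mu:
  assumes "\<mu> > 0" "set_integrable lborel {0..1} f"
  shows "set_integrable lborel {0..1} (f_mu \<mu> f)"
proof (rule set_integrable_bound)
  show "set_integrable lborel {0..1} (\<lambda>x. (1 / ln (1 + \<mu>)) * f x)"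
    using assms(2) by simp
  show "set_borel_measurable lborel {0..1} (f_mu \<mu> f)"
    using assms(2) by (intro set_borel_measurable_f_mu)
       (simp add: set_integrable_def set_borel_measurable_def borel_measurable_integrable)
  show "AE x in lborel. x \<in> {0..1} \<longrightarrow> norm (f_mu \<mu> f x) \<le> norm (1 / ln (1 + \<mu>) * f x)"
    using abs_f_mu_le[OF assms(1)] assms(1) by (intro AE_I2 impI) (simp add: abs_mult)
qed

lemma LK_add:
  assumes "\<mu> > 0" "set_integrable lborel {0..1} f" "set_integrable lborel {0..1} g"
  shows "LK \<mu> n (\<lambda>x. f x + g x) x = LK \<mu> n f x + LK \<mu> n g x"
proof -
  have "avg n k (f_mu \<mu> (\<lambda>x. f x + g x)) = avg n k (f_mu \<mu> f) + avg n k (f_mu \<mu> g)" if "k \<le> n" for k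
    using avg_add[OF cell_integrable[OF that set_integrable_f_mu[OF assms(1,2)]]
      cell_integrable[OF that set_integrable_f_mu[OF assms(1,3)]]]
    by (simp add: f_mu_def[abs_def] add_divide_distrib)
  then show ?thesis
    by (simp add: LK_eq distrib_left sum.distrib)
qed

text \<open>\<open>f\<close> enters only through finitely many numbers
  \<open>avg n k (f_mu \<mu> f)\<close>, so the image is continuous whatever \<open>f\<close> is,
  and hence in every L^p.\<close>

lemma continuous_on_LK:
  assumes "\<mu> > 0"
  shows "continuous_on {0..1} (LK \<mu> n f)"
  unfolding LK_eq[abs_def] ln_mu_def using assms
  by (intro continuous_intros continuous_on_bern_a_seq) auto

lemma set_integral_sum_indexed:
  fixes F :: "'i \<Rightarrow> 'a \<Rightarrow> real"
  assumes "\<And>i. i \<in> I \<Longrightarrow> set_integrable M A (F i)"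
  shows "set_integrable M A (\<lambda>x. \<Sum>i\<in>I. F i x)"
    "(LINT x:A|M. (\<Sum>i\<in>I. F i x)) = (\<Sum>i\<in>I. LINT x:A|M. F i x)"
  using assms unfolding set_integrable_def set_lebesgue_integral_def scaleR_sum_right
  by (auto intro!: Bochner_Integration.integral_sum)

text \<open>Jensen is used twice, for the Bernstein weights at a fixed point and for each cell mean.
  Integration then gives each weight at most \<open>K_mu \<mu> / (n + 1)\<close>, and the
  \<open>n + 1\<close> cancels against \<open>sum_avg_le\<close>. The quotient of logarithms comes
  from the maximum of \<open>ln_mu\<close> outside and its minimum inside the means.\<close>

lemma Lp_norm01_LK_le:
  assumes mu: "\<mu> > 0" and p: "p > 1" and u: "in_Lp01 p u"
  shows "Lp_norm01 p (LK \<mu> n u) \<le> ln (2 + \<mu>) / ln (1 + \<mu>) * K_mu \<mu> * Lp_norm01 p u"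
proof -
  define L where "L = ln (2 + \<mu>) / ln (1 + \<mu>)"
  have L: "L > 0" using mu by (simp add: L_def)
  let ?w = "\<lambda>k x. bern n k (a_seq \<mu> (n + 1) x)"
  have w: "?w k x \<ge> 0" if "x \<in> {0..1}" for k x
    using that a_seq_bounds[OF mu, of "n + 1" x] by (auto intro!: bern_nonneg)
  have ui: "set_integrable lborel {0..1} u" "set_integrable lborel {0..1} (\<lambda>t. \<bar>u t\<bar>)"
    "set_integrable lborel {0..1} (\<lambda>t. \<bar>u t\<bar> powr p)"
    using in_Lp01_integrable[OF _ u] p u by (auto simp: in_Lp01_def intro: set_integrable_abs)
  have fi: "set_integrable lborel {0..1} (f_mu \<mu> u)" "set_integrable lborel {0..1} (\<lambda>t. \<bar>f_mu \<mu> u t\<bar>)"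
    using set_integrable_f_mu[OF mu ui(1)] by (auto intro: set_integrable_abs)
  define J where "J k = avg n k (\<lambda>t. \<bar>u t\<bar> powr p)" for k
  have J: "J k \<ge> 0" if "k \<le> n" for k
  proof -
    have "avg n k (\<lambda>_. 0) \<le> J k" unfolding J_def
      by (intro avg_mono cell_integrable that ui cell_integrable_const) auto
    then show ?thesis by simp
  qed
  have pw: "\<bar>LK \<mu> n u x\<bar> powr p \<le> L powr p * (\<Sum>k\<le>n. ?w k x * J k)" if x: "x \<in> {0..1}" for x
  proof -
    have avg_le: "\<bar>avg n k (f_mu \<mu> u)\<bar> \<le> 1 / ln (1 + \<mu>) * avg n k (\<lambda>t. \<bar>u t\<bar>)" if k: "k \<le> n" for k
    proof -
      have "\<bar>avg n k (f_mu \<mu> u)\<bar> \<le> avg n k (\<lambda>t. \<bar>f_mu \<mu> u t\<bar>)"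
        by (intro avg_abs cell_integrable k fi)
      also have "\<dots> \<le> avg n k (\<lambda>t. 1 / ln (1 + \<mu>) * \<bar>u t\<bar>)"
        using cell_subset(2)[OF k]
        by (intro avg_mono cell_integrable k fi set_integrable_mult_right ui abs_f_mu_le mu) auto
      finally show ?thesis by (simp only: avg_cmult)
    qed
    have "\<bar>\<Sum>k\<le>n. ?w k x * avg n k (f_mu \<mu> u)\<bar>
        \<le> (\<Sum>k\<le>n. ?w k x * (1 / ln (1 + \<mu>) * avg n k (\<lambda>t. \<bar>u t\<bar>)))"
    proof (intro order_trans[OF sum_abs] sum_mono)
      fix k assume "k \<in> {..n}"
      then show "\<bar>?w k x * avg n k (f_mu \<mu> u)\<bar> \<le> ?w k x * (1 / ln (1 + \<mu>) * avg n k (\<lambda>t. \<bar>u t\<bar>))"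
        unfolding abs_mult abs_of_nonneg[OF w[OF x]] using w[OF x] avg_le by (intro mult_left_mono) auto
    qed
    also have "\<dots> = 1 / ln (1 + \<mu>) * (\<Sum>k\<le>n. ?w k x * avg n k (\<lambda>t. \<bar>u t\<bar>))"
      by (simp add: sum_distrib_left mult_ac)
    finally have "\<bar>LK \<mu> n u x\<bar> \<le> ln (2 + \<mu>) * (1 / ln (1 + \<mu>) * (\<Sum>k\<le>n. ?w k x * avg n k (\<lambda>t. \<bar>u t\<bar>)))"
      unfolding LK_eq abs_mult using ln_mu_bounds[OF mu, of x] x mu
      by (intro mult_mono) auto
    then have "\<bar>LK \<mu> n u x\<bar> \<le> L * (\<Sum>k\<le>n. ?w k x * avg n k (\<lambda>t. \<bar>u t\<bar>))"
      by (simp add: L_def)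
    then have "\<bar>LK \<mu> n u x\<bar> powr p \<le> (L * (\<Sum>k\<le>n. ?w k x * avg n k (\<lambda>t. \<bar>u t\<bar>))) powr p"
      using p by (intro powr_mono2) auto
    also have "\<dots> = L powr p * (\<Sum>k\<le>n. ?w k x * avg n k (\<lambda>t. \<bar>u t\<bar>)) powr p"
      by (rule powr_mult)
    also have "(\<Sum>k\<le>n. ?w k x * avg n k (\<lambda>t. \<bar>u t\<bar>)) powr p \<le> (\<Sum>k\<le>n. ?w k x * avg n k (\<lambda>t. \<bar>u t\<bar>) powr p)"
    proof (rule powr_convex_sum[OF p])
      fix k assume "k \<in> {..n}"
      then have "avg n k (\<lambda>_. 0) \<le> avg n k (\<lambda>t. \<bar>u t\<bar>)"
        by (intro avg_mono cell_integrable ui cell_integrable_const) auto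
      then show "0 \<le> avg n k (\<lambda>t. \<bar>u t\<bar>)" by simp
    qed (use w[OF x] sum_bern in auto)
    also have "\<dots> \<le> (\<Sum>k\<le>n. ?w k x * J k)"
      unfolding J_def using w[OF x]
      by (intro sum_mono mult_left_mono avg_powr p cell_integrable ui) auto
    finally show ?thesis by (simp add: mult_left_mono)
  qed
  have wi: "set_integrable lborel {0..1} (\<lambda>x. ?w k x * J k)" for k
    using borel_integrable_atLeastAtMost'[OF continuous_on_bern_a_seq[OF mu]]
    by (intro set_integrable_mult_left) auto
  have "(LINT x:{0..1}|lborel. \<bar>LK \<mu> n u x\<bar> powr p)
      \<le> (LINT x:{0..1}|lborel. L powr p * (\<Sum>k\<le>n. ?w k x * J k))"
  proof (rule set_integral_mono)
    show "set_integrable lborel {0..1} (\<lambda>x. \<bar>LK \<mu> n u x\<bar> powr p)"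
      using continuous_in_Lp01[OF continuous_on_LK[OF mu]] p by (simp add: in_Lp01_def)
    show "set_integrable lborel {0..1} (\<lambda>x. L powr p * (\<Sum>k\<le>n. ?w k x * J k))"
      by (intro set_integrable_mult_right set_integral_sum_indexed wi)
  qed (rule pw)
  also have "\<dots> = L powr p * (\<Sum>k\<le>n. (LINT x:{0..1}|lborel. ?w k x) * J k)"
    using wi by (simp add: set_integral_sum_indexed(2))
  also have "\<dots> \<le> L powr p * (\<Sum>k\<le>n. K_mu \<mu> / real (n + 1) * J k)"
    by (intro mult_left_mono sum_mono mult_right_mono integral_bern_a_seq mu J) auto
  also have "\<dots> = L powr p * (K_mu \<mu> / real (n + 1) * (\<Sum>k\<le>n. J k))"
    by (simp add: sum_distrib_left)
  also have "\<dots> \<le> L powr p * (K_mu \<mu> / real (n + 1) * (real (n + 1) * (LINT t:{0..1}|lborel. \<bar>u t\<bar> powr p)))"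
    unfolding J_def using mu by (intro mult_left_mono sum_avg_le ui) (auto simp: K_mu_def)
  also have "\<dots> = L powr p * (K_mu \<mu> * Lp_norm01 p u powr p)"
    using p by (simp add: Lp_norm01_powr set_lebesgue_integral_def abs_indicator_powr)
  also have "\<dots> \<le> L powr p * (K_mu \<mu> powr p * Lp_norm01 p u powr p)"
  proof -
    \<comment> \<open>The argument gives the p-th root of \<open>K_mu \<mu>\<close>; as
      \<open>K_mu \<mu> \<ge> 1\<close>, this may be replaced by \<open>K_mu \<mu>\<close>
      itself.\<close>
    have "K_mu \<mu> \<ge> 1" using mu by (simp add: K_mu_def)
    then have "K_mu \<mu> powr 1 \<le> K_mu \<mu> powr p" using p by (intro powr_mono) auto
    then show ?thesis using \<open>K_mu \<mu> \<ge> 1\<close> by (intro mult_left_mono mult_right_mono) auto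
  qed
  also have "\<dots> = (L * K_mu \<mu> * Lp_norm01 p u) powr p"
    using L mu by (simp add: powr_mult)
  finally show ?thesis
    using p L mu unfolding L_def[symmetric]
    by (intro Lp_norm01_leI) (auto simp: set_lebesgue_integral_def abs_indicator_powr K_mu_def intro!: mult_nonneg_nonneg)
qed

section \<open>The Sobolev estimate\<close>

text \<open>A family consisting of the single interval between two points suffices, hence the index
  type \<open>unit\<close>.\<close>

lemma abs_cont01_imp_continuous_on:
  assumes "abs_cont01 g" shows "continuous_on {0..1} g"
  unfolding continuous_on_iff
proof (intro ballI allI impI)
  fix x e :: real assume x: "x \<in> {0..1}" and e: "e > 0"
  have "\<exists>d>0. \<forall>(I :: unit set) a b. finite I \<and> (\<forall>i\<in>I. 0 \<le> a i \<and> a i \<le> b i \<and> b i \<le> 1) \<and>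
      (\<forall>i\<in>I. \<forall>j\<in>I. i \<noteq> j \<longrightarrow> b i \<le> a j \<or> b j \<le> a i) \<and>
      (\<Sum>i\<in>I. b i - a i) < d \<longrightarrow> (\<Sum>i\<in>I. \<bar>g (b i) - g (a i)\<bar>) < e"
    (is "\<exists>d>0. ?P d") using abs_cont01_finite_family[OF assms e] .
  then obtain d where d': "d > 0 \<and> ?P d" ..
  then have d: "d > 0" and P: "?P d" by (rule conjunct1, rule conjunct2)
  have close: "\<bar>g v - g u\<bar> < e" if "0 \<le> u" "u \<le> v" "v \<le> 1" "v - u < d" for u v
    using P[THEN spec[of _ "{()}"], THEN spec[of _ "\<lambda>_. u"], THEN spec[of _ "\<lambda>_. v"]] that by simp
  show "\<exists>d>0. \<forall>x'\<in>{0..1}. dist x' x < d \<longrightarrow> dist (g x') (g x) < e"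
  proof (intro exI[of _ d] conjI ballI impI d)
    fix y assume y: "y \<in> {0..1}" "dist y x < d"
    show "dist (g y) (g x) < e"
      using close[of x y] close[of y x] x y by (cases "x \<le> y") (auto simp: dist_real_def abs_minus_commute)
  qed
qed

text \<open>The quotient inherits absolute continuity because \<open>g\<close> is bounded,
  \<open>ln_mu\<close> stays above \<open>ln (1 + \<mu>)\<close>, and \<open>ln_mu\<close> has
  Lipschitz constant 1.\<close>

lemma abs_cont01_f_mu:
  assumes mu: "\<mu> > 0" and g: "abs_cont01 g"
  shows "abs_cont01 (f_mu \<mu> g)"
  unfolding abs_cont01_def
proof (intro allI impI)
  fix e :: real assume e: "e > 0"
  define l where "l = ln (1 + \<mu>)"
  have l: "l > 0" using mu by (simp add: l_def)
  have "bounded (g ` {0..1})"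
    using abs_cont01_imp_continuous_on[OF g] by (intro compact_imp_bounded compact_continuous_image) auto
  then obtain B where B: "B > 0" "\<And>x. x \<in> {0..1} \<Longrightarrow> \<bar>g x\<bar> \<le> B"
    unfolding bounded_pos by auto
  have lip: "\<bar>f_mu \<mu> g v - f_mu \<mu> g u\<bar> \<le> \<bar>g v - g u\<bar> / l + B / l\<^sup>2 * (v - u)"
    if uv: "0 \<le> u" "u \<le> v" "v \<le> 1" for u v
  proof -
    let ?a = "ln_mu \<mu> u" and ?b = "ln_mu \<mu> v"
    have ab: "l \<le> ?a" "l \<le> ?b" "0 < ?a" "0 < ?b"
      using ln_mu_bounds[OF mu, of u] ln_mu_bounds[OF mu, of v] uv by (auto simp: l_def)
    have "?b - ?a = ln ((1 + \<mu> + v) / (1 + \<mu> + u))"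
      using uv mu by (simp add: ln_mu_def ln_div)
    also have "\<dots> \<le> (1 + \<mu> + v) / (1 + \<mu> + u) - 1"
      using uv mu by (intro ln_le_minus_one) auto
    also have "\<dots> = (v - u) / (1 + \<mu> + u)" using uv mu by (simp add: field_simps)
    also have "\<dots> \<le> (v - u) / 1" using uv mu by (intro divide_left_mono) auto
    finally have "?b - ?a \<le> v - u" by simp
    moreover have "?a \<le> ?b" using uv mu by (simp add: ln_mu_def)
    ultimately have d: "\<bar>?a - ?b\<bar> \<le> v - u" by simp
    have "f_mu \<mu> g v - f_mu \<mu> g u = (g v - g u) / ?b + g u * (?a - ?b) / (?a * ?b)"
      using ab by (simp add: f_mu_def field_simps)
    also have "\<bar>\<dots>\<bar> \<le> \<bar>(g v - g u) / ?b\<bar> + \<bar>g u * (?a - ?b) / (?a * ?b)\<bar>" by (rule abs_triangle_ineq)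
    also have "\<dots> = \<bar>g v - g u\<bar> / ?b + \<bar>g u\<bar> * \<bar>?a - ?b\<bar> / (?a * ?b)"
      using ab by (simp add: abs_mult)
    also have "\<dots> \<le> \<bar>g v - g u\<bar> / l + B * (v - u) / (l * l)"
      using ab l B d uv by (intro add_mono frac_le mult_mono mult_nonneg_nonneg mult_pos_pos) auto
    finally show ?thesis by (simp add: power2_eq_square)
  qed
  have e2: "e * l / 2 > 0" using e l by simp
  have "\<exists>d>0. \<forall>(n::nat) a b.
     (\<forall>i<n. 0 \<le> a i \<and> a i \<le> b i \<and> b i \<le> 1) \<and>
     (\<forall>i<n. \<forall>j<n. i \<noteq> j \<longrightarrow> b i \<le> a j \<or> b j \<le> a i) \<and>
     (\<Sum>i<n. b i - a i) < d \<longrightarrow> (\<Sum>i<n. \<bar>g (b i) - g (a i)\<bar>) < e * l / 2"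
    (is "\<exists>d>0. ?P d") using g[unfolded abs_cont01_def, THEN spec, THEN mp, OF e2] .
  then obtain d where d': "d > 0 \<and> ?P d" ..
  then have d: "d > 0" and P: "?P d" by (rule conjunct1, rule conjunct2)
  \<comment> \<open>The first entry controls the increments of \<open>g\<close> divided by
    \<open>l\<close>, the second the Lipschitz part; each contributes less than
    \<open>e / 2\<close>.\<close>
  define d1 where "d1 = min d (e * l\<^sup>2 / (2 * B))"
  have d1: "d1 > 0" using d e l B by (simp add: d1_def)
  show "\<exists>d>0. \<forall>(n::nat) a b.
     (\<forall>i<n. 0 \<le> a i \<and> a i \<le> b i \<and> b i \<le> 1) \<and>
     (\<forall>i<n. \<forall>j<n. i \<noteq> j \<longrightarrow> b i \<le> a j \<or> b j \<le> a i) \<and>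
     (\<Sum>i<n. b i - a i) < d \<longrightarrow> (\<Sum>i<n. \<bar>f_mu \<mu> g (b i) - f_mu \<mu> g (a i)\<bar>) < e"
  proof (rule exI[of _ d1], rule conjI[OF d1], intro allI impI)
    fix n :: nat and a b
    assume asm: "(\<forall>i<n. 0 \<le> a i \<and> a i \<le> b i \<and> b i \<le> 1) \<and>
     (\<forall>i<n. \<forall>j<n. i \<noteq> j \<longrightarrow> b i \<le> a j \<or> b j \<le> a i) \<and> (\<Sum>i<n. b i - a i) < d1"
    then have len: "(\<Sum>i<n. b i - a i) < d1" and ab: "\<And>i. i < n \<Longrightarrow> 0 \<le> a i \<and> a i \<le> b i \<and> b i \<le> 1"
      by auto
    have "(\<Sum>i<n. \<bar>g (b i) - g (a i)\<bar>) < e * l / 2"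
      by (rule P[THEN spec, THEN spec, THEN spec, THEN mp]) (use asm in \<open>simp add: d1_def\<close>)
    then have 1: "(\<Sum>i<n. \<bar>g (b i) - g (a i)\<bar>) / l < e / 2" using l by (simp add: field_simps)
    have "B / l\<^sup>2 * (\<Sum>i<n. b i - a i) < B / l\<^sup>2 * (e * l\<^sup>2 / (2 * B))"
      using len B l by (intro mult_strict_left_mono) (auto simp: d1_def)
    also have "\<dots> = e / 2" using B l by simp
    finally have 2: "B / l\<^sup>2 * (\<Sum>i<n. b i - a i) < e / 2" .
    have "(\<Sum>i<n. \<bar>f_mu \<mu> g (b i) - f_mu \<mu> g (a i)\<bar>)
        \<le> (\<Sum>i<n. \<bar>g (b i) - g (a i)\<bar> / l + B / l\<^sup>2 * (b i - a i))"
      using ab by (intro sum_mono lip) auto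
    also have "\<dots> = (\<Sum>i<n. \<bar>g (b i) - g (a i)\<bar>) / l + B / l\<^sup>2 * (\<Sum>i<n. b i - a i)"
      by (simp only: sum.distrib sum_divide_distrib sum_distrib_left)
    finally show "(\<Sum>i<n. \<bar>f_mu \<mu> g (b i) - f_mu \<mu> g (a i)\<bar>) < e" using 1 2 by linarith
  qed
qed

text \<open>The quotient rule, with division by the squared logarithm expressed as a double
  \<open>f_mu\<close> so that \<open>abs_f_mu_le\<close> can be applied twice.\<close>

definition f_mu_deriv :: "real \<Rightarrow> (real \<Rightarrow> real) \<Rightarrow> (real \<Rightarrow> real) \<Rightarrow> real \<Rightarrow> real" where
  "f_mu_deriv \<mu> g h x = f_mu \<mu> h x - f_mu \<mu> (f_mu \<mu> g) x / (1 + \<mu> + x)"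

lemma has_real_derivative_f_mu:
  assumes "\<mu> > 0" "x \<in> {0..1}" "(g has_real_derivative h x) (at x within {0..1})"
  shows "(f_mu \<mu> g has_real_derivative f_mu_deriv \<mu> g h x) (at x within {0..1})"
proof -
  have pos: "0 < ln_mu \<mu> x" "1 + \<mu> + x > 0" using ln_mu_bounds[OF assms(1), of x] assms by auto
  have ln: "(ln_mu \<mu> has_real_derivative 1 / (1 + \<mu> + x)) (at x within {0..1})"
    unfolding ln_mu_def using pos(2) by (auto intro!: derivative_eq_intros)
  have "((\<lambda>x. g x / ln_mu \<mu> x) has_real_derivative
      (h x * ln_mu \<mu> x - g x * (1 / (1 + \<mu> + x))) / (ln_mu \<mu> x * ln_mu \<mu> x)) (at x within {0..1})"
    using pos by (intro DERIV_divide assms(3) ln) auto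
  also have "(h x * ln_mu \<mu> x - g x * (1 / (1 + \<mu> + x))) / (ln_mu \<mu> x * ln_mu \<mu> x) = f_mu_deriv \<mu> g h x"
    using pos by (simp add: f_mu_deriv_def f_mu_def diff_divide_distrib mult_ac)
  finally show ?thesis by (simp add: f_mu_def[abs_def])
qed

text \<open>Pulling out a common \<open>1 / ln (1 + \<mu>)\<close> leaves the coefficient 1 at
  \<open>h\<close> and, at \<open>g\<close>, precisely the first entry of the maximum in
  \<open>C_p_mu\<close>.\<close>

lemma f_mu_deriv_Lp:
  assumes mu: "\<mu> > 0" and p: "p > 1" and g: "in_Lp01 p g" and h: "in_Lp01 p h"
  shows "in_Lp01 p (f_mu_deriv \<mu> g h)"
    and "Lp_norm01 p (f_mu_deriv \<mu> g h)
      \<le> (Lp_norm01 p h + Lp_norm01 p g / ((1 + \<mu>) * ln (1 + \<mu>))) / ln (1 + \<mu>)"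
proof -
  define l where "l = ln (1 + \<mu>)"
  have l: "l > 0" using mu by (simp add: l_def)
  have p0: "p > 0" using p by simp
  let ?F = "\<lambda>x. (1 / l) * \<bar>h x\<bar> + (1 / ((1 + \<mu>) * l * l)) * \<bar>g x\<bar>"
  have abs: "in_Lp01 p (\<lambda>x. \<bar>f x\<bar>)" "Lp_norm01 p (\<lambda>x. \<bar>f x\<bar>) = Lp_norm01 p f" if f: "in_Lp01 p f" for f
  proof -
    have m: "(\<lambda>x. indicator {0..1} x * f x) \<in> borel_measurable lborel" using f by (simp add: in_Lp01_iff)
    then have "(\<lambda>x. \<bar>indicator {0..1} x * f x\<bar>) \<in> borel_measurable lborel" by measurable
    then show "in_Lp01 p (\<lambda>x. \<bar>f x\<bar>)" using f by (simp add: in_Lp01_iff abs_mult)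
    show "Lp_norm01 p (\<lambda>x. \<bar>f x\<bar>) = Lp_norm01 p f" by (simp add: Lp_norm01_def)
  qed
  note F = in_Lp01_add[OF p in_Lp01_cmult(1)[OF p0 abs(1)[OF h]] in_Lp01_cmult(1)[OF p0 abs(1)[OF g]]]
  have meas: "set_borel_measurable lborel {0..1} (f_mu_deriv \<mu> g h)"
  proof -
    have [measurable]: "(\<lambda>x. indicator {0..1} x * g x) \<in> borel_measurable lborel"
      "(\<lambda>x. indicator {0..1} x * h x) \<in> borel_measurable lborel"
      using g h by (auto simp: in_Lp01_iff)
    have "(\<lambda>x. (indicator {0..1} x * h x) / ln (1 + \<mu> + x)
        - (indicator {0..1} x * g x) / ln (1 + \<mu> + x) / ln (1 + \<mu> + x) / (1 + \<mu> + x)) \<in> borel_measurable lborel"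
      by measurable
    then show ?thesis
      by (simp add: set_borel_measurable_def f_mu_deriv_def f_mu_def ln_mu_def right_diff_distrib)
  qed
  have le: "\<bar>f_mu_deriv \<mu> g h x\<bar> \<le> \<bar>?F x\<bar>" if x: "x \<in> {0..1}" for x
  proof -
    have *: "\<bar>f_mu \<mu> f x\<bar> \<le> 1 / l * \<bar>f x\<bar>" for f
      using abs_f_mu_le[OF mu, of x f] x by (simp add: l_def)
    have "\<bar>f_mu \<mu> (f_mu \<mu> g) x / (1 + \<mu> + x)\<bar> \<le> \<bar>f_mu \<mu> (f_mu \<mu> g) x\<bar> / (1 + \<mu>)"
      using x mu by (simp add: abs_div frac_le)
    also have "\<bar>f_mu \<mu> (f_mu \<mu> g) x\<bar> \<le> 1 / l * (1 / l * \<bar>g x\<bar>)"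
      using l by (intro order_trans[OF *] mult_left_mono *) auto
    then have "\<bar>f_mu \<mu> (f_mu \<mu> g) x\<bar> / (1 + \<mu>) \<le> 1 / l * (1 / l * \<bar>g x\<bar>) / (1 + \<mu>)"
      using mu by (intro divide_right_mono) auto
    finally have "\<bar>f_mu \<mu> (f_mu \<mu> g) x / (1 + \<mu> + x)\<bar> \<le> 1 / ((1 + \<mu>) * l * l) * \<bar>g x\<bar>"
      by (simp add: mult_ac)
    then have "\<bar>f_mu_deriv \<mu> g h x\<bar> \<le> ?F x"
      using *[of h] unfolding f_mu_deriv_def by linarith
    then show ?thesis by linarith
  qed
  note H = in_Lp01_mono[OF p0 F(1) meas AE_I2]
  show "in_Lp01 p (f_mu_deriv \<mu> g h)" by (rule H(1)) (use le in blast)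
  have "Lp_norm01 p (f_mu_deriv \<mu> g h) \<le> Lp_norm01 p ?F" by (rule H(2)) (use le in blast)
  also have "\<dots> \<le> 1 / l * Lp_norm01 p h + 1 / ((1 + \<mu>) * l * l) * Lp_norm01 p g"
  proof -
    have "\<bar>1 / l\<bar> = 1 / l" "\<bar>1 / ((1 + \<mu>) * l * l)\<bar> = 1 / ((1 + \<mu>) * l * l)" using l mu by auto
    then show ?thesis
      using F(2)[of "1 / l" "1 / ((1 + \<mu>) * l * l)"]
      unfolding in_Lp01_cmult(2)[OF p0 abs(1)[OF h]] in_Lp01_cmult(2)[OF p0 abs(1)[OF g]]
         abs(2)[OF h] abs(2)[OF g] by simp
  qed
  also have "\<dots> = (Lp_norm01 p h + Lp_norm01 p g / ((1 + \<mu>) * l)) / l"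
    using l mu by (simp add: add_divide_distrib mult_ac)
  finally show "Lp_norm01 p (f_mu_deriv \<mu> g h)
      \<le> (Lp_norm01 p h + Lp_norm01 p g / ((1 + \<mu>) * ln (1 + \<mu>))) / ln (1 + \<mu>)"
    by (simp add: l_def)
qed

text \<open>By the fundamental theorem of calculus the increment is at most the integral of
  \<open>\<bar>H\<bar>\<close> between the points, which is \<open>\<bar>t - x\<bar>\<close> times
  the quotient sampled by \<open>maxfun\<close> at \<open>t\<close>.\<close>

lemma increment_le_maxfun:
  assumes ac: "abs_cont01 G"
    and deriv: "AE x in lborel. x \<in> {0..1} \<longrightarrow> (G has_real_derivative H x) (at x within {0..1})"
    and int: "set_integrable lborel {0..1} H"
    and x: "x \<in> {0..1}" and t: "t \<in> {0<..1}" and fin: "maxfun H x < \<infinity>"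
  shows "\<bar>G t - G x\<bar> \<le> real_of_ereal (maxfun H x) * \<bar>t - x\<bar>"
proof (cases "t = x")
  case False
  have ftc: "\<bar>G v - G u\<bar> \<le> (LINT y:{u..v}|lborel. \<bar>H y\<bar>)" if uv: "0 \<le> u" "u \<le> v" "v \<le> 1" for u v
  proof -
    have i: "set_integrable lborel {u..v} H"
      using int by (rule set_integrable_subset) (use uv in auto)
    have "(H has_integral (LINT y:{u..v}|lborel. H y)) {u..v}"
      using set_borel_integral_eq_integral[OF i] by (simp add: has_integral_iff)
    then have "G v - G u = (LINT y:{u..v}|lborel. H y)"
      using abs_cont01_has_integral[OF ac deriv uv] by (rule has_integral_unique[rotated])
    then show ?thesis using set_integral_norm_bound[OF i] by simp
  qed
  define q where "q = interval_lebesgue_integral lborel (ereal x) (ereal t) (\<lambda>u. \<bar>H u\<bar>) / (t - x)"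
  have "ereal q \<le> maxfun H x"
    unfolding maxfun_def q_def using t False by (intro SUP_upper) auto
  \<comment> \<open>Finiteness matters here: \<open>real_of_ereal\<close> sends infinity to
    0.\<close>
  then have q: "q \<le> real_of_ereal (maxfun H x)" using fin by (cases "maxfun H x") auto
  have "\<bar>G t - G x\<bar> \<le> q * \<bar>t - x\<bar>"
  proof (cases "x < t")
    case True
    then show ?thesis using ftc[of x t] x t by (simp add: q_def interval_integral_Icc)
  next
    case False
    then have "t < x" using \<open>t \<noteq> x\<close> by simp
    \<comment> \<open>For \<open>t < x\<close> both the oriented integral and \<open>t - x\<close>
      change sign, so \<open>q\<close> is still a mean of \<open>\<bar>H\<bar>\<close>.\<close>
    then have "q * (t - x) = - (LINT y:{t..x}|lborel. \<bar>H y\<bar>)"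
      unfolding q_def interval_integral_endpoints_reverse[of "ereal x"]
      by (simp add: interval_integral_Icc)
    then have "q * \<bar>t - x\<bar> = (LINT y:{t..x}|lborel. \<bar>H y\<bar>)"
      using \<open>t < x\<close> by (simp add: abs_if algebra_simps)
    then show ?thesis using ftc[of t x] x t \<open>t < x\<close> by (simp add: abs_minus_commute)
  qed
  also have "\<dots> \<le> real_of_ereal (maxfun H x) * \<bar>t - x\<bar>" using q by (intro mult_right_mono) auto
  finally show ?thesis .
qed simp

text \<open>Three deviations add up: from \<open>t\<close> to \<open>k / n\<close> and from the node
  \<open>y\<close> to \<open>x\<close>, each at most \<open>1 / (n + 1)\<close>, and from
  \<open>k / n\<close> to \<open>y\<close>, handled by \<open>sum_bern_abs_dev\<close>.\<close>

lemma sum_bern_avg_dev: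
  assumes mu: "\<mu> > 0" and n: "n > 0" and x: "x \<in> {0..1}"
  shows "(\<Sum>k\<le>n. bern n k (a_seq \<mu> (n + 1) x) * avg n k (\<lambda>t. \<bar>t - x\<bar>))
    \<le> 2 / real (n + 1) + 1 / (2 * sqrt (real n))"
proof -
  define y where "y = a_seq \<mu> (n + 1) x"
  have y: "0 \<le> y" "y \<le> 1" using a_seq_bounds[OF mu, of "n + 1" x] x by (auto simp: y_def)
  have yx: "\<bar>y - x\<bar> \<le> 1 / real (n + 1)" using a_seq_dev[OF mu, of "n + 1" x] x by (simp add: y_def)
  have "avg n k (\<lambda>t. \<bar>t - x\<bar>) \<le> \<bar>real k / real n - y\<bar> + 2 / real (n + 1)" if k: "k \<le> n" for k
  proof -
    have "avg n k (\<lambda>t. \<bar>t - x\<bar>) \<le> avg n k (\<lambda>_. \<bar>real k / real n - y\<bar> + 2 / real (n + 1))"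
    proof (rule avg_mono)
      have "continuous_on {0..1} (\<lambda>t. \<bar>t - x\<bar>)" by (intro continuous_intros)
      then show "set_integrable lborel (cell n k) (\<lambda>t. \<bar>t - x\<bar>)"
        by (intro cell_integrable k borel_integrable_atLeastAtMost')
      fix t assume "t \<in> cell n k"
      moreover have "real k / real (n + 1) \<le> real k / real n"
        using n by (intro divide_left_mono) auto
      \<comment> \<open>With the preceding line this places \<open>k / n\<close> in the closure of
        the cell; the inequality amounts to \<open>k \<le> n\<close>.\<close>
      moreover have "real k / real n \<le> real (k + 1) / real (n + 1)"
        using n k by (simp add: field_simps)
      moreover have "real (k + 1) / real (n + 1) = real k / real (n + 1) + 1 / real (n + 1)"
        by (simp add: add_divide_distrib)
      ultimately have "\<bar>t - real k / real n\<bar> \<le> 1 / real (n + 1)"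
        unfolding cell_def greaterThanLessThan_iff abs_le_iff by linarith
      moreover have "2 / real (n + 1) = 1 / real (n + 1) + 1 / real (n + 1)" by simp
      ultimately show "\<bar>t - x\<bar> \<le> \<bar>real k / real n - y\<bar> + 2 / real (n + 1)" using yx by linarith
    qed simp
    then show ?thesis by simp
  qed
  then have "(\<Sum>k\<le>n. bern n k y * avg n k (\<lambda>t. \<bar>t - x\<bar>))
      \<le> (\<Sum>k\<le>n. bern n k y * (\<bar>real k / real n - y\<bar> + 2 / real (n + 1)))"
    using y by (intro sum_mono mult_left_mono bern_nonneg) auto
  also have "\<dots> = (\<Sum>k\<le>n. bern n k y * \<bar>real k / real n - y\<bar>) + 2 / real (n + 1)"
    unfolding distrib_left sum.distrib sum_distrib_right[symmetric] sum_bern by simp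
  also have "\<dots> \<le> 1 / (2 * sqrt (real n)) + 2 / real (n + 1)"
    using sum_bern_abs_dev[OF n y] by simp
  finally show ?thesis by (simp add: y_def)
qed

text \<open>Wherever the maximal function of \<open>H\<close> is finite, the error is at most
  \<open>ln (2 + \<mu>) * S\<close> times that function. The assumed maximal inequality and
  \<open>f_mu_deriv_Lp\<close> then turn this into Sobolev norms of \<open>g\<close>.\<close>

lemma Lp_norm01_LK_diff_le:
  assumes mu: "\<mu> > 0" and p: "p > 1" and C: "maximal_const p C" and W: "W1p_deriv p g h" and n: "n > 0"
  shows "in_Lp01 p (\<lambda>x. LK \<mu> n g x - g x)"
    and "Lp_norm01 p (\<lambda>x. LK \<mu> n g x - g x)
      \<le> ln (2 + \<mu>) / ln (1 + \<mu>) * (2 / real (n + 1) + 1 / (2 * sqrt (real n))) * C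
        * (Lp_norm01 p h + Lp_norm01 p g / ((1 + \<mu>) * ln (1 + \<mu>)))"
proof -
  define S where "S = 2 / real (n + 1) + 1 / (2 * sqrt (real n))"
  have S: "S \<ge> 0" by (simp add: S_def)
  have C0: "C > 0" using C by (simp add: maximal_const_def)
  have l: "ln (1 + \<mu>) > 0" "ln (2 + \<mu>) > 0" using mu by auto
  have g: "abs_cont01 g" "in_Lp01 p h" and dg: "AE x in lborel. x \<in> {0..1} \<longrightarrow> (g has_real_derivative h x) (at x within {0..1})"
    using W by (auto simp: W1p_deriv_def)
  have cont: "continuous_on {0..1} g" by (rule abs_cont01_imp_continuous_on[OF g(1)])
  have gp: "in_Lp01 p g" using continuous_in_Lp01[OF cont] p by simp
  define G where "G = f_mu \<mu> g"
  define H where "H = f_mu_deriv \<mu> g h"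
  define M where "M x = real_of_ereal (maxfun H x)" for x
  have Hp: "in_Lp01 p H" unfolding H_def by (rule f_mu_deriv_Lp(1)[OF mu p gp g(2)])
  have acG: "abs_cont01 G" unfolding G_def by (rule abs_cont01_f_mu[OF mu g(1)])
  have dG: "AE x in lborel. x \<in> {0..1} \<longrightarrow> (G has_real_derivative H x) (at x within {0..1})"
    using dg by eventually_elim (auto simp: G_def H_def intro: has_real_derivative_f_mu[OF mu])
  have Hi: "set_integrable lborel {0..1} H" using in_Lp01_integrable[OF _ Hp] p by simp
  have Gi: "set_integrable lborel {0..1} G"
    using abs_cont01_imp_continuous_on[OF acG] by (rule borel_integrable_atLeastAtMost')
  have Mx: "AE x in lborel. x \<in> {0..1} \<longrightarrow> maxfun H x < \<infinity>" and Mp: "in_Lp01 p M"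
    and MC: "Lp_norm01 p M \<le> C * Lp_norm01 p H"
    using C Hp by (auto simp: maximal_const_def M_def[abs_def])
  have pw: "\<bar>LK \<mu> n g x - g x\<bar> \<le> \<bar>ln (2 + \<mu>) * S * M x\<bar>" if x: "x \<in> {0..1}" and fin: "maxfun H x < \<infinity>" for x
  proof -
    let ?w = "\<lambda>k. bern n k (a_seq \<mu> (n + 1) x)"
    have w: "?w k \<ge> 0" for k
      using x a_seq_bounds[OF mu, of "n + 1" x] by (auto intro!: bern_nonneg)
    have lx: "0 < ln_mu \<mu> x" "ln_mu \<mu> x \<le> ln (2 + \<mu>)" using ln_mu_bounds[OF mu, of x] x by auto
    have inc: "\<bar>G t - G x\<bar> \<le> M x * \<bar>t - x\<bar>" if "t \<in> {0<..1}" for t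
      unfolding M_def by (rule increment_le_maxfun[OF acG dG Hi x that fin])
    have M0: "M x \<ge> 0"
    proof -
      \<comment> \<open>One of 1 and 1/2 differs from \<open>x\<close>, and the increment bound at
        that point forces \<open>M x\<close> to be nonnegative.\<close>
      obtain t :: real where t: "t \<in> {0<..1}" "t \<noteq> x" using that[of 1] that[of "1/2"] by force
      have "0 \<le> M x * \<bar>t - x\<bar>" using inc[OF t(1)] by linarith
      then show ?thesis using t(2) by (simp add: zero_le_mult_iff)
    qed
    have ci: "set_integrable lborel (cell n k) (\<lambda>t. G t - G x)"
      "set_integrable lborel (cell n k) (\<lambda>t. \<bar>G t - G x\<bar>)"
      "set_integrable lborel (cell n k) (\<lambda>t. M x * \<bar>t - x\<bar>)" if k: "k \<le> n" for k
    proof -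
      show *: "set_integrable lborel (cell n k) (\<lambda>t. G t - G x)"
        by (intro set_integral_diff cell_integrable k Gi cell_integrable_const)
      show "set_integrable lborel (cell n k) (\<lambda>t. \<bar>G t - G x\<bar>)" using * by (rule set_integrable_abs)
      have "continuous_on {0..1} (\<lambda>t. M x * \<bar>t - x\<bar>)" by (intro continuous_intros)
      then show "set_integrable lborel (cell n k) (\<lambda>t. M x * \<bar>t - x\<bar>)"
        by (intro cell_integrable k borel_integrable_atLeastAtMost')
    qed
    have a: "\<bar>avg n k (\<lambda>t. G t - G x)\<bar> \<le> M x * avg n k (\<lambda>t. \<bar>t - x\<bar>)" if k: "k \<le> n" for k
    proof -
      have "\<bar>avg n k (\<lambda>t. G t - G x)\<bar> \<le> avg n k (\<lambda>t. \<bar>G t - G x\<bar>)" by (intro avg_abs ci k)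
      also have "\<dots> \<le> avg n k (\<lambda>t. M x * \<bar>t - x\<bar>)"
        using cell_subset(1)[OF k] by (intro avg_mono ci k inc) auto
      finally show ?thesis by (simp only: avg_cmult)
    qed
    have "LK \<mu> n g x - g x = ln_mu \<mu> x * ((\<Sum>k\<le>n. ?w k * avg n k G) - G x)"
      using lx by (simp add: LK_eq G_def f_mu_def right_diff_distrib)
    \<comment> \<open>The weights sum to 1, so \<open>G x\<close> can be moved into each cell mean,
      leaving only increments of \<open>G\<close>.\<close>
    also have "(\<Sum>k\<le>n. ?w k * avg n k G) - G x = (\<Sum>k\<le>n. ?w k * avg n k G) - (\<Sum>k\<le>n. ?w k * G x)"
      by (simp add: sum_distrib_right[symmetric] sum_bern)
    also have "\<dots> = (\<Sum>k\<le>n. ?w k * avg n k (\<lambda>t. G t - G x))"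
      unfolding sum_subtractf[symmetric]
    proof (intro sum.cong refl)
      fix k assume "k \<in> {..n}"
      then show "?w k * avg n k G - ?w k * G x = ?w k * avg n k (\<lambda>t. G t - G x)"
        using avg_diff[OF cell_integrable[OF _ Gi] cell_integrable_const, of k n "G x"]
        by (simp add: right_diff_distrib)
    qed
    finally have "\<bar>LK \<mu> n g x - g x\<bar> = ln_mu \<mu> x * \<bar>\<Sum>k\<le>n. ?w k * avg n k (\<lambda>t. G t - G x)\<bar>"
      using lx by (simp add: abs_mult)
    also have "\<dots> \<le> ln (2 + \<mu>) * (M x * S)"
    proof (intro mult_mono lx)
      have "\<bar>\<Sum>k\<le>n. ?w k * avg n k (\<lambda>t. G t - G x)\<bar> \<le> (\<Sum>k\<le>n. ?w k * (M x * avg n k (\<lambda>t. \<bar>t - x\<bar>)))"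
      proof (intro order_trans[OF sum_abs] sum_mono)
        fix k assume "k \<in> {..n}"
        then show "\<bar>?w k * avg n k (\<lambda>t. G t - G x)\<bar> \<le> ?w k * (M x * avg n k (\<lambda>t. \<bar>t - x\<bar>))"
          unfolding abs_mult abs_of_nonneg[OF w] using w a by (intro mult_left_mono) auto
      qed
      also have "\<dots> = M x * (\<Sum>k\<le>n. ?w k * avg n k (\<lambda>t. \<bar>t - x\<bar>))"
        by (simp add: sum_distrib_left mult_ac)
      also have "\<dots> \<le> M x * S"
        unfolding S_def by (intro mult_left_mono sum_bern_avg_dev mu n x M0)
      finally show "\<bar>\<Sum>k\<le>n. ?w k * avg n k (\<lambda>t. G t - G x)\<bar> \<le> M x * S" .
    qed (use l in auto)
    also have "\<dots> = ln (2 + \<mu>) * S * M x" by simp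
    finally show ?thesis by linarith
  qed
  have p0: "p > 0" using p by simp
  have contd: "continuous_on {0..1} (\<lambda>x. LK \<mu> n g x - g x)"
    by (intro continuous_on_diff continuous_on_LK mu cont)
  then show d: "in_Lp01 p (\<lambda>x. LK \<mu> n g x - g x)" using p0 by (rule continuous_in_Lp01)
  have "Lp_norm01 p (\<lambda>x. LK \<mu> n g x - g x) \<le> Lp_norm01 p (\<lambda>x. ln (2 + \<mu>) * S * M x)"
  proof (rule in_Lp01_mono(2)[OF p0 in_Lp01_cmult(1)[OF p0 Mp]])
    show "set_borel_measurable lborel {0..1} (\<lambda>x. LK \<mu> n g x - g x)" using d by (simp add: in_Lp01_def)
    show "AE x in lborel. x \<in> {0..1} \<longrightarrow> \<bar>LK \<mu> n g x - g x\<bar> \<le> \<bar>ln (2 + \<mu>) * S * M x\<bar>"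
      using Mx by eventually_elim (use pw in blast)
  qed
  also have "\<dots> = ln (2 + \<mu>) * S * Lp_norm01 p M"
    using l S by (simp add: in_Lp01_cmult(2)[OF p0 Mp])
  also have "\<dots> \<le> ln (2 + \<mu>) * S * (C * ((Lp_norm01 p h + Lp_norm01 p g / ((1 + \<mu>) * ln (1 + \<mu>))) / ln (1 + \<mu>)))"
  proof -
    have "Lp_norm01 p M \<le> C * ((Lp_norm01 p h + Lp_norm01 p g / ((1 + \<mu>) * ln (1 + \<mu>))) / ln (1 + \<mu>))"
      using C0 f_mu_deriv_Lp(2)[OF mu p gp g(2)]
      by (intro order_trans[OF MC] mult_left_mono) (auto simp: H_def)
    then show ?thesis using l S by (intro mult_left_mono) auto
  qed
  also have "\<dots> = ln (2 + \<mu>) / ln (1 + \<mu>) * S * C * (Lp_norm01 p h + Lp_norm01 p g / ((1 + \<mu>) * ln (1 + \<mu>)))"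
    by simp
  finally show "Lp_norm01 p (\<lambda>x. LK \<mu> n g x - g x)
      \<le> ln (2 + \<mu>) / ln (1 + \<mu>) * (2 / real (n + 1) + 1 / (2 * sqrt (real n))) * C
        * (Lp_norm01 p h + Lp_norm01 p g / ((1 + \<mu>) * ln (1 + \<mu>)))"
    by (simp add: S_def)
qed

section \<open>Comparison with the prescribed constants\<close>

lemma gamma_n_nonneg: "\<mu> > 0 \<Longrightarrow> 0 \<le> gamma_n \<mu> n"
  using a_seq_dev_le_gamma_n[of \<mu> 0 n] by simp

text \<open>The factor \<open>2 / 3\<close> is the room left by \<open>1 / (2 * sqrt n)\<close> being smaller than
  \<open>sqrt 2 / sqrt (n + 1)\<close>; it pays for the constant \<open>C_p_mu\<close> being a maximum where the
  estimate produces a product.\<close>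
lemma dev_le_T_n:
  assumes mu: "\<mu> > 0" and n: "n \<ge> 48"
  shows "2 / real (n + 1) + 1 / (2 * sqrt (real n)) \<le> 2 / 3 * T_n \<mu> n"
proof -
  define s where "s = sqrt (real (n + 1))"
  define r where "r = sqrt (real n)"
  have ss: "s * s = real (n + 1)" by (simp add: s_def)
  \<comment> \<open>The origin of 48: \<open>s \<ge> 7\<close> turns the \<open>2 / (n + 1)\<close>
    term, which is \<open>2 / (s * s)\<close>, into at most \<open>2/7 / s\<close>.\<close>
  have "sqrt (7\<^sup>2) \<le> s" unfolding s_def using n by (intro real_sqrt_le_mono) simp
  then have s: "s \<ge> 7" by simp
  have r: "r > 0" using n by (simp add: r_def)
  \<comment> \<open>This replaces \<open>sqrt n\<close> by \<open>s\<close> at the cost of 6/5,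
    giving \<open>3/5 / s\<close>; the total 31/35 must stay below
    \<open>2/3 * sqrt 2\<close>.\<close>
  have "s \<le> sqrt ((6/5)\<^sup>2 * real n)" unfolding s_def using n by (intro real_sqrt_le_mono) (simp add: power2_eq_square)
  then have sr: "s \<le> 6/5 * r" by (simp add: real_sqrt_mult r_def)
  have "1 / (2 * r) \<le> 3/5 / s" using sr r s by (simp add: field_simps)
  moreover have "2 / real (n + 1) \<le> 2/7 / s" using s unfolding ss[symmetric] by (simp add: field_simps)
  moreover have "2/7 / s + 3/5 / s = 31/35 / s" by (simp add: add_divide_distrib[symmetric])
  ultimately have "2 / real (n + 1) + 1 / (2 * r) \<le> 31/35 / s" by linarith
  also have "\<dots> \<le> 2 / 3 * (sqrt 2 / s)"
  proof -
    have "7/5 \<le> sqrt 2" by (rule real_le_rsqrt) (simp add: power2_eq_square)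
    then have "31/35 \<le> 2/3 * sqrt 2" by simp
    then show ?thesis using s divide_right_mono[of "31/35" "2/3 * sqrt 2" s] by simp
  qed
  also have "\<dots> \<le> 2 / 3 * T_n \<mu> n"
    unfolding T_n_def s_def using gamma_n_nonneg[OF mu] by simp
  finally show ?thesis by (simp add: r_def)
qed

text \<open>The constant \<open>2 / 3\<close> is a lower bound of \<open>ln 2\<close>, hence of
  \<open>ln (2 + \<mu>)\<close>, so \<open>2 / 3\<close> times the second entry of the maximum is at
  most \<open>2 / 3 / ln (1 + \<mu>)\<close> and thus at most \<open>L\<close>. The entry 1 is
  covered by \<open>L \<ge> 1\<close>, and \<open>C\<close> by \<open>C_p_mu\<close>.\<close>

lemma max_product_le_C_p_mu:
  assumes mu: "\<mu> > 0" and C: "C > 0"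
  shows "2 / 3 * C * max 1 (1 / ((1 + \<mu>) * ln (1 + \<mu>))) \<le> ln (2 + \<mu>) / ln (1 + \<mu>) * C_p_mu C \<mu>"
proof -
  define l where "l = ln (1 + \<mu>)"
  define L where "L = ln (2 + \<mu>) / l"
  have l: "l > 0" using mu by (simp add: l_def)
  have "ln 2 \<le> ln (2 + \<mu>)" using mu by simp
  then have l2: "2 / 3 \<le> ln (2 + \<mu>)" using ln2_ge_two_thirds by linarith
  have "l \<le> ln (2 + \<mu>)" using mu by (simp add: l_def)
  then have L1: "1 \<le> L" using l by (simp add: L_def)
  have "2 / 3 * (1 / ((1 + \<mu>) * l)) = 2 / 3 / (1 + \<mu>) / l" by simp
  also have "\<dots> \<le> 2 / 3 / l" using mu l by (intro divide_right_mono) (auto simp: divide_le_eq)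
  also have "\<dots> \<le> L" unfolding L_def using l2 l by (intro divide_right_mono) auto
  finally have "2 / 3 * (1 / ((1 + \<mu>) * l)) \<le> L" .
  moreover have "2 / 3 * 1 \<le> L" using L1 by simp
  ultimately have "2 / 3 * max 1 (1 / ((1 + \<mu>) * l)) \<le> L" unfolding max_def by (simp only: simp_thms split: if_split)
  then have "(2 / 3 * max 1 (1 / ((1 + \<mu>) * l))) * C \<le> L * C_p_mu C \<mu>"
    using C L1 by (intro mult_mono) (auto simp: C_p_mu_def)
  then show ?thesis by (simp add: L_def l_def mult_ac)
qed

text \<open>One factor \<open>L\<close> comes from the operator estimate and becomes the outer
  factor; the other, contained in \<open>Gamma_n\<close>, is supplied by
  \<open>max_product_le_C_p_mu\<close>.\<close>

lemma Lp_norm01_LK_W1p_le: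
  assumes mu: "\<mu> > 0" and p: "1 < p" and C: "maximal_const p Cp" and W: "W1p_deriv p g h" and n: "n \<ge> 48"
  shows "Lp_norm01 p (\<lambda>x. LK \<mu> n g x - g x)
    \<le> ln (2 + \<mu>) / ln (1 + \<mu>) * (K_mu \<mu> + 1) * (Gamma_n p Cp \<mu> n * (Lp_norm01 p g + Lp_norm01 p h))"
proof -
  define L where "L = ln (2 + \<mu>) / ln (1 + \<mu>)"
  define m where "m = 1 / ((1 + \<mu>) * ln (1 + \<mu>))"
  define S where "S = 2 / real (n + 1) + 1 / (2 * sqrt (real n))"
  define N where "N = Lp_norm01 p g + Lp_norm01 p h"
  have Cp: "Cp > 0" using C by (simp add: maximal_const_def)
  have L: "L > 0" using mu by (simp add: L_def)
  have K: "K_mu \<mu> + 1 > 0" using mu by (simp add: K_mu_def add_pos_pos)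
  have S: "0 \<le> S" "S \<le> 2 / 3 * T_n \<mu> n" using dev_le_T_n[OF mu n] by (auto simp: S_def)
  then have T: "T_n \<mu> n \<ge> 0" by simp
  have N: "N \<ge> 0" by (simp add: N_def)
  have "Lp_norm01 p (\<lambda>x. LK \<mu> n g x - g x) \<le> L * S * Cp * (Lp_norm01 p h + m * Lp_norm01 p g)"
    using Lp_norm01_LK_diff_le(2)[OF mu p C W, of n] n by (simp add: L_def S_def m_def)
  also have "\<dots> \<le> L * S * Cp * (max 1 m * N)"
  proof -
    \<comment> \<open>Both coefficients are raised to \<open>max 1 m\<close>, so that the sum of the
      two norms factors out.\<close>
    have "1 * Lp_norm01 p h + m * Lp_norm01 p g \<le> max 1 m * Lp_norm01 p h + max 1 m * Lp_norm01 p g"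
      by (intro add_mono mult_right_mono) auto
    then show ?thesis
      using L S(1) Cp by (intro mult_left_mono) (auto simp: N_def algebra_simps)
  qed
  also have "\<dots> \<le> L * (2 / 3 * T_n \<mu> n) * Cp * (max 1 m * N)"
    using L S Cp N by (intro mult_right_mono mult_left_mono) auto
  also have "\<dots> = L * T_n \<mu> n * N * (2 / 3 * Cp * max 1 m)" by simp
  also have "\<dots> \<le> L * T_n \<mu> n * N * (L * C_p_mu Cp \<mu>)"
    using max_product_le_C_p_mu[OF mu Cp, folded L_def m_def] L T N by (intro mult_left_mono) auto
  also have "\<dots> = 1 * (L * T_n \<mu> n * N * (L * C_p_mu Cp \<mu>))" by simp
  \<comment> \<open>The exponent is positive, so the factor is at least 1 and only weakens the
    bound.\<close>
  also have "\<dots> \<le> 2 powr ((p - 1) / p) * (L * T_n \<mu> n * N * (L * C_p_mu Cp \<mu>))"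
    using p L T N Cp by (intro mult_right_mono) (auto simp: ge_one_powr_ge_zero C_p_mu_def)
  also have "\<dots> = L * (K_mu \<mu> + 1) * (Gamma_n p Cp \<mu> n * N)"
    using K by (simp add: Gamma_n_def L_def)
  finally show ?thesis by (simp add: L_def N_def)
qed

section \<open>Passage to the K-functional\<close>

lemma Lp_norm01_uminus: "Lp_norm01 p (\<lambda>x. - f x) = Lp_norm01 p f"
  by (simp add: Lp_norm01_def)

theorem theorem6p3:
  fixes \<mu> p Cp :: real and f :: "real \<Rightarrow> real"
  assumes "\<mu> > 0" and "1 < p"
    and "maximal_const p Cp"
    and "in_Lp01 p f"
  shows "\<forall>\<^sub>F n in sequentially.
           Lp_norm01 p (\<lambda>x. LK \<mu> n f x - f x)
             \<le> ln (2 + \<mu>) / ln (1 + \<mu>) * (K_mu \<mu> + 1) * Kfun p f (Gamma_n p Cp \<mu> n)"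
  using eventually_ge_at_top[of 48]
proof eventually_elim
  case (elim n)
  note mu = assms(1) and p = assms(2)
  define L where "L = ln (2 + \<mu>) / ln (1 + \<mu>)"
  define A where "A = L * (K_mu \<mu> + 1)"
  define t where "t = Gamma_n p Cp \<mu> n"
  have L: "L \<ge> 1" using mu by (simp add: L_def)
  have A: "A > 0" using L mu by (simp add: A_def K_mu_def add_pos_pos)
  let ?X = "{Lp_norm01 p (\<lambda>x. f x - g x) + t * (Lp_norm01 p g + Lp_norm01 p h) | g h. W1p_deriv p g h}"
  have key: "Lp_norm01 p (\<lambda>x. LK \<mu> n f x - f x)
      \<le> A * (Lp_norm01 p (\<lambda>x. f x - g x) + t * (Lp_norm01 p g + Lp_norm01 p h))"
    if W: "W1p_deriv p g h" for g h
  proof -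
    have ac: "abs_cont01 g" using W by (simp add: W1p_deriv_def)
    have gp: "in_Lp01 p g"
      using continuous_in_Lp01[OF abs_cont01_imp_continuous_on[OF ac]] p by simp
    define u where "u x = f x - g x" for x
    have up: "in_Lp01 p u"
      using in_Lp01_add(1)[OF p assms(4) in_Lp01_cmult(1)[OF _ gp, of "-1"]] p
      by (simp add: u_def[abs_def])
    have mup: "in_Lp01 p (\<lambda>x. - u x)" using in_Lp01_cmult(1)[OF _ up, of "-1"] p by simp
    have i: "set_integrable lborel {0..1} u" "set_integrable lborel {0..1} g"
      using in_Lp01_integrable[of p] up gp p by auto
    have Lu: "in_Lp01 p (LK \<mu> n u)" using continuous_in_Lp01[OF continuous_on_LK[OF mu]] p by simp
    have "(\<lambda>x. LK \<mu> n f x - f x) = (\<lambda>x. (LK \<mu> n u x + - u x) + (LK \<mu> n g x - g x))"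
      using LK_add[OF mu i, of n] by (simp add: u_def fun_eq_iff)
    then have "Lp_norm01 p (\<lambda>x. LK \<mu> n f x - f x)
        \<le> Lp_norm01 p (\<lambda>x. LK \<mu> n u x + - u x) + Lp_norm01 p (\<lambda>x. LK \<mu> n g x - g x)"
      using in_Lp01_add(2)[OF p in_Lp01_add(1)[OF p Lu mup]
          Lp_norm01_LK_diff_le(1)[OF mu p assms(3) W, of n]] elim by simp
    also have "Lp_norm01 p (\<lambda>x. LK \<mu> n u x + - u x) \<le> Lp_norm01 p (LK \<mu> n u) + Lp_norm01 p u"
      using in_Lp01_add(2)[OF p Lu mup] by (simp add: Lp_norm01_uminus)
    also have "Lp_norm01 p (LK \<mu> n u) \<le> L * K_mu \<mu> * Lp_norm01 p u"
      using Lp_norm01_LK_le[OF mu p up] by (simp add: L_def)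
    \<comment> \<open>The term \<open>- u\<close> costs an extra 1, absorbed by
      \<open>L \<ge> 1\<close>:
      \<open>L * K_mu \<mu> + 1 \<le> L * (K_mu \<mu> + 1)\<close>.\<close>
    also have "L * K_mu \<mu> * Lp_norm01 p u + Lp_norm01 p u \<le> A * Lp_norm01 p u"
      using mult_right_mono[OF L Lp_norm01_nonneg[of p u]] by (simp add: A_def algebra_simps)
    also have "Lp_norm01 p (\<lambda>x. LK \<mu> n g x - g x) \<le> A * (t * (Lp_norm01 p g + Lp_norm01 p h))"
      using Lp_norm01_LK_W1p_le[OF mu p assms(3) W elim] by (simp add: A_def L_def t_def)
    finally show ?thesis by (simp add: u_def[abs_def] distrib_left)
  qed
  \<comment> \<open>A competitor must exist: \<open>cInf_greatest\<close> requires a nonempty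
    set.\<close>
  have "W1p_deriv p (\<lambda>_. 0) (\<lambda>_. 0)"
  proof -
    have "in_Lp01 p (\<lambda>_. 0)" using p by (intro continuous_in_Lp01) auto
    moreover have "abs_cont01 (\<lambda>_. 0)" by (auto simp: abs_cont01_def intro: exI[of _ 1])
    ultimately show ?thesis by (simp add: W1p_deriv_def)
  qed
  then have "?X \<noteq> {}" by blast
  \<comment> \<open>After division by \<open>A\<close>, \<open>key\<close> says that the left side
    is a lower bound of all competitors, so the infimum need not be attained.\<close>
  then have "Lp_norm01 p (\<lambda>x. LK \<mu> n f x - f x) / A \<le> Inf ?X"
    by (rule cInf_greatest) (use key A in \<open>auto simp: pos_divide_le_eq mult.commute\<close>)
  then have "Lp_norm01 p (\<lambda>x. LK \<mu> n f x - f x) \<le> A * Kfun p f t"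
    unfolding Kfun_def using A by (simp only: pos_divide_le_eq mult.commute)
  then show ?case by (simp only: A_def L_def t_def)
qed

end
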